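(* Let $\Delta H$ be a valid Hilbert function with conjugate $\Delta H^\star=(h_1^\star,\ldots,h_\alpha^\star)$. Then the following procedure can be carried out, terminates, and outputs a scheme $Z$ of double points and reduced points in $\mathbb{P}^2$ with $H_Z=H$. STEP $0$. Let $\ell_1,\ldots,\ell_\alpha$ be lines in $\mathbb{P}^2$ such that no three meet at a point, and let $P_{i,j}=\ell_i\cap\ell_j$ for $1\le i<j\le\alpha$. Let $Z_0\subseteq\bigcup_{i=1}^\alpha\ell_i$ be a set of reduced points with $|Z_0\cap\ell_i|=h_i^\star$ for all $i$ and such that no point of $Z_0$ is of the form $\ell_i\cap\ell_j$ with $i\neq j$ (so that $H_{Z_0}=H$). Continue to STEP $1$. STEP $n$ (for $n\ge1$). Set $$s_n=\#\{k \mid n+1\le k\le\alpha \text{ and } h_k^\star\ge n\}.$$ If $s_n=0$, return $Z_{n-1}$. Otherwise let $$t_n=\min\left\{\left\lfloor\frac{(h_n^\star-(n-1))_+}{2}\right\rfloor,\ s_n\right\}.$$ Remove from $Z_{n-1}$ a total of $2t_n$ reduced points on $\ell_n$ and one reduced point on each $\ell_j$ for $j=n+1,\ldots,n+t_n$, and add the double points $2P_{n,j}$ for $j=n+1,\ldots,n+t_n$. Let $Z_n$ denote the resulting scheme. Continue to STEP $n+1$.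
   Context: Let $k$ be an algebraically closed field of characteristic zero, $\mathbb{P}^2=\mathbb{P}^2_k$ and $R=k[x_0,x_1,x_2]$ with the standard grading. For distinct points $P_1,\ldots,P_s\in\mathbb{P}^2$ with homogeneous ideals $I_{P_i}$ and positive integers $m_i$, the set of fat points $Z=m_1P_1+\cdots+m_sP_s$ is the scheme defined by $I_Z=I_{P_1}^{m_1}\cap\cdots\cap I_{P_s}^{m_s}$; a point with $m_i=2$ is a double point of $Z$ (written $2P_i$), and one with $m_i=1$ is a reduced point of $Z$. The Hilbert function of $Z$ is $H_Z(i)=\dim_k(R/I_Z)_i$. A valid Hilbert function is a finite sequence of positive integers $\Delta H=(h_0,\ldots,h_\sigma)$, $\sigma\ge1$, for which there is an integer $\alpha$ with $1\le\alpha\le\sigma+1$ such that $h_i=i+1$ for $0\le i<\alpha$ and $\alpha\ge h_\alpha\ge h_{\alpha+1}\ge\cdots\ge h_\sigma$. The corresponding function $H:\mathbb{N}\to\mathbb{N}$ is $H(i)=\sum_{j=0}^i h_j$ (with $h_j=0$ for $j>\sigma$). The conjugate of $\Delta H$ is $\Delta H^\star=(h_1^\star,\ldots,h_\alpha^\star)$ with $h_i^\star=\#\{j\mid h_j\ge i\}$. For an integer $n$, $n_+=\max\{n,0\}$. *)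

theory Defs
  imports "HOL-Analysis.Cartesian_Space" "HOL-Library.Poly_Mapping" "HOL-Library.Multiset"
    "HOL-Computational_Algebra.Polynomial"
begin

section \<open>Dimension of a quotient of vector spaces\<close>

text \<open>
  The classes of the elements of \<open>B\<close> are pairwise distinct and form a (finite) basis of the quotient
  space \<open>V / W\<close>.
\<close>
definition quotient_basis ::
    "('a::field \<Rightarrow> 'b::ab_group_add \<Rightarrow> 'b) \<Rightarrow> 'b set \<Rightarrow> 'b set \<Rightarrow> 'b set \<Rightarrow> bool" where
  "quotient_basis smul V W B \<longleftrightarrow> finite B \<and> B \<subseteq> V \<and>
     (\<forall>c. (\<Sum>b\<in>B. smul (c b) b) \<in> W \<longrightarrow> (\<forall>b\<in>B. c b = 0)) \<and>
     (\<forall>v\<in>V. \<exists>c. v - (\<Sum>b\<in>B. smul (c b) b) \<in> W)"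

definition quotient_dim ::
    "('a::field \<Rightarrow> 'b::ab_group_add \<Rightarrow> 'b) \<Rightarrow> 'b set \<Rightarrow> 'b set \<Rightarrow> nat" where
  "quotient_dim smul V W = (THE n. \<exists>B. quotient_basis smul V W B \<and> card B = n)"

locale smul_space = vector_space smul
  for smul :: "'a::field \<Rightarrow> 'b::ab_group_add \<Rightarrow> 'b"
begin

lemma quotient_basis_card:
  assumes W: "subspace W" and V: "subspace V" and WV: "W \<subseteq> V" and fin: "finite F" "V \<subseteq> span F"
    and B: "quotient_basis smul V W B"
  shows "card B + dim W = dim V"
proof -
  obtain C where C: "C \<subseteq> W" "independent C" "W \<subseteq> span C" "card C = dim W"
    using basis_exists by blast
  have finC: "finite C"
    using independent_span_bound[OF fin(1) C(2)] C(1) WV fin(2) by blast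
  have spC: "span C = W"
    using C(1,3) W by (simp add: span_minimal subset_antisym)
  have finB: "finite B" and BV: "B \<subseteq> V"
    and ind: "\<And>c. (\<Sum>b\<in>B. smul (c b) b) \<in> W \<Longrightarrow> \<forall>b\<in>B. c b = 0"
    and gen: "\<And>v. v \<in> V \<Longrightarrow> \<exists>c. v - (\<Sum>b\<in>B. smul (c b) b) \<in> W"
    using B unfolding quotient_basis_def by blast+
  have disj: "B \<inter> C = {}"
  proof (rule ccontr)
    assume "B \<inter> C \<noteq> {}"
    then obtain b where b: "b \<in> B" "b \<in> C" by blast
    have "(\<Sum>x\<in>B. smul (if x = b then 1 else 0) x) = (\<Sum>x\<in>B. if x = b then x else 0)"
      by (intro sum.cong) auto
    also have "\<dots> = b" using finB b by simp
    finally have "(\<Sum>x\<in>B. smul (if x = b then 1 else 0) x) \<in> W" using b C(1) by auto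
    from ind[OF this] b(1) show False by auto
  qed
  have indep: "independent (B \<union> C)"
  proof
    assume "dependent (B \<union> C)"
    then obtain u where u: "\<exists>v\<in>B \<union> C. u v \<noteq> 0" "(\<Sum>v\<in>B \<union> C. smul (u v) v) = 0"
      using dependent_finite[of "B \<union> C"] finB finC by auto
    have eq: "(\<Sum>v\<in>B. smul (u v) v) + (\<Sum>v\<in>C. smul (u v) v) = 0"
      using u(2) sum.union_disjoint[OF finB finC disj, of "\<lambda>v. smul (u v) v"] by simp
    have "(\<Sum>v\<in>C. smul (u v) v) \<in> W"
      using C(1) W by (intro subspace_sum subspace_scale) auto
    moreover have "(\<Sum>v\<in>B. smul (u v) v) = - (\<Sum>v\<in>C. smul (u v) v)"
      using eq by (simp add: eq_neg_iff_add_eq_0)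
    ultimately have "(\<Sum>v\<in>B. smul (u v) v) \<in> W"
      using W by (simp add: subspace_neg)
    from ind[OF this] have z: "\<forall>b\<in>B. u b = 0" .
    then have "(\<Sum>v\<in>C. smul (u v) v) = 0" using eq by simp
    then have "\<forall>v\<in>C. u v = 0" using C(2) dependent_finite[OF finC] by blast
    with z u(1) show False by blast
  qed
  have "V \<subseteq> span (B \<union> C)"
  proof
    fix v assume "v \<in> V"
    from gen[OF this] obtain c where c: "v - (\<Sum>b\<in>B. smul (c b) b) \<in> span C"
      using spC by blast
    have "(\<Sum>b\<in>B. smul (c b) b) \<in> span (B \<union> C)"
      by (intro span_sum span_scale span_base) auto
    moreover have "v - (\<Sum>b\<in>B. smul (c b) b) \<in> span (B \<union> C)"
      using c span_mono[of C "B \<union> C"] by auto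
    ultimately have "(v - (\<Sum>b\<in>B. smul (c b) b)) + (\<Sum>b\<in>B. smul (c b) b) \<in> span (B \<union> C)"
      by (intro span_add)
    then show "v \<in> span (B \<union> C)" by simp
  qed
  moreover have "B \<union> C \<subseteq> V" using BV C(1) WV by blast
  ultimately have "card (B \<union> C) = dim V"
    using indep by (intro basis_card_eq_dim) auto
  then show ?thesis using card_Un_disjoint[OF finB finC disj] C(4) by simp
qed

lemma quotient_basis_exists:
  assumes W: "subspace W" and V: "subspace V" and WV: "W \<subseteq> V" and fin: "finite F" "V \<subseteq> span F"
  shows "\<exists>B. quotient_basis smul V W B"
proof -
  obtain C where C: "C \<subseteq> W" "independent C" "W \<subseteq> span C" "card C = dim W"
    using basis_exists by blast
  have "C \<subseteq> V" using C(1) WV by simp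
  then obtain D where D: "C \<subseteq> D" "D \<subseteq> V" "independent D" "V \<subseteq> span D"
    using maximal_independent_subset_extend[of C V] C(2) by metis
  have finD: "finite D"
    using independent_span_bound[OF fin(1) D(3)] D(2) fin(2) by blast
  have finC: "finite C" using D(1) finD finite_subset by blast
  have spC: "span C = W"
    using C(1,3) W by (simp add: span_minimal subset_antisym)
  have split: "(\<Sum>v\<in>D. f v) = (\<Sum>v\<in>D - C. f v) + (\<Sum>v\<in>C. f v)" for f :: "'b \<Rightarrow> 'b"
    using sum.subset_diff[OF D(1) finD] by simp
  have "quotient_basis smul V W (D - C)"
    unfolding quotient_basis_def
  proof (intro conjI allI impI ballI)
    show "finite (D - C)" "D - C \<subseteq> V" using finD D(2) by auto
  next
    fix c b assume c: "(\<Sum>b\<in>D - C. smul (c b) b) \<in> W" and b: "b \<in> D - C"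
    obtain u where u: "(\<Sum>b\<in>D - C. smul (c b) b) = (\<Sum>v\<in>C. smul (u v) v)"
      using c spC span_finite[OF finC] by auto
    define w where "w v = (if v \<in> C then - u v else c v)" for v
    have "(\<Sum>v\<in>D. smul (w v) v) = (\<Sum>v\<in>D - C. smul (c v) v) + (\<Sum>v\<in>C. smul (- u v) v)"
      unfolding split by (intro arg_cong2[where f = "(+)"] sum.cong) (auto simp: w_def)
    also have "\<dots> = 0" by (simp add: u sum_negf)
    finally have "\<forall>v\<in>D. w v = 0" using D(3) dependent_finite[OF finD] by blast
    then show "c b = 0" using b by (auto simp: w_def)
  next
    fix v assume "v \<in> V"
    then obtain u where u: "v = (\<Sum>b\<in>D. smul (u b) b)"
      using D(4) span_finite[OF finD] by auto
    have "v - (\<Sum>b\<in>D - C. smul (u b) b) = (\<Sum>b\<in>C. smul (u b) b)"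
      by (simp add: u split)
    also have "\<dots> \<in> W"
      using C(1) W by (intro subspace_sum subspace_scale) auto
    finally show "\<exists>c. v - (\<Sum>b\<in>D - C. smul (c b) b) \<in> W" by blast
  qed
  then show ?thesis ..
qed

lemma quotient_dim_eq:
  assumes "subspace W" "subspace V" "W \<subseteq> V" "finite F" "V \<subseteq> span F"
  shows "quotient_dim smul V W = dim V - dim W"
proof -
  obtain B where B: "quotient_basis smul V W B" using quotient_basis_exists[OF assms] by blast
  show ?thesis
    unfolding quotient_dim_def
  proof (rule the_equality)
    show "\<exists>B. quotient_basis smul V W B \<and> card B = dim V - dim W"
      using B quotient_basis_card[OF assms B] by (intro exI[of _ B]) simp
  next
    fix n assume "\<exists>B. quotient_basis smul V W B \<and> card B = n"
    then obtain B' where "quotient_basis smul V W B'" "card B' = n" by blast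
    then show "n = dim V - dim W" using quotient_basis_card[OF assms, of B'] by simp
  qed
qed

end


section \<open>The polynomial ring in three variables\<close>

text \<open>
  Elements of \<open>k[x\<^sub>0, x\<^sub>1, x\<^sub>2]\<close> are finitely supported functions from exponent vectors to coefficients,
  multiplied by convolution; the three variables are indexed by the type \<open>3\<close>.
\<close>
type_synonym monom3 = "3 \<Rightarrow>\<^sub>0 nat"
type_synonym 'k poly3 = "monom3 \<Rightarrow>\<^sub>0 'k"

definition mdeg :: "monom3 \<Rightarrow> nat" where
  "mdeg m = (\<Sum>i\<in>UNIV. Poly_Mapping.lookup m i)"

definition eval3 :: "'k::field poly3 \<Rightarrow> 'k ^ 3 \<Rightarrow> 'k" where
  "eval3 f v = (\<Sum>m\<in>Poly_Mapping.keys f.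
     Poly_Mapping.lookup f m * (\<Prod>i\<in>UNIV. (v $ i) ^ Poly_Mapping.lookup m i))"

definition homogeneous_part :: "nat \<Rightarrow> 'k::field poly3 set" where
  "homogeneous_part d = {f. \<forall>m\<in>Poly_Mapping.keys f. mdeg m = d}"

definition scale3 :: "'k::field \<Rightarrow> 'k poly3 \<Rightarrow> 'k poly3" where
  "scale3 c f = Poly_Mapping.single 0 c * f"

interpretation poly3: smul_space "scale3 :: 'k::field \<Rightarrow> 'k poly3 \<Rightarrow> 'k poly3"
proof
  fix a b :: 'k and x y :: "'k poly3"
  show "scale3 a (x + y) = scale3 a x + scale3 a y" by (simp add: scale3_def algebra_simps)
  show "scale3 (a + b) x = scale3 a x + scale3 b x"
    by (simp add: scale3_def single_add algebra_simps)
  show "scale3 a (scale3 b x) = scale3 (a * b) x"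
    by (simp add: scale3_def mult_single mult.assoc[symmetric])
  show "scale3 1 x = x" by (simp add: scale3_def)
qed

definition ideal_gen :: "'k::field poly3 set \<Rightarrow> 'k poly3 set" where
  "ideal_gen S = module.span (*) S"

primrec ideal_pow :: "'k::field poly3 set \<Rightarrow> nat \<Rightarrow> 'k poly3 set" where
  "ideal_pow I 0 = UNIV"
| "ideal_pow I (Suc m) = ideal_gen {f * g | f g. f \<in> I \<and> g \<in> ideal_pow I m}"

definition hilbert_fun :: "'k::field poly3 set \<Rightarrow> nat \<Rightarrow> nat" where
  "hilbert_fun I d = quotient_dim scale3 (homogeneous_part d) (I \<inter> homogeneous_part d)"


section \<open>The projective plane and fat points\<close>

definition proj_rel :: "'k::field ^ 3 \<Rightarrow> 'k ^ 3 \<Rightarrow> bool" where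
  "proj_rel u v \<longleftrightarrow> u \<noteq> 0 \<and> v \<noteq> 0 \<and> (\<exists>c. c \<noteq> 0 \<and> v = c *s u)"

lemma proj_rel_part_equivp: "part_equivp (proj_rel :: 'k::field ^ 3 \<Rightarrow> _)"
proof (rule part_equivpI)
  have "proj_rel (1 :: 'k ^ 3) 1"
    unfolding proj_rel_def by (auto simp: vec_eq_iff intro!: exI[of _ 1])
  then show "\<exists>x. proj_rel (x :: 'k ^ 3) x" ..
  show "symp (proj_rel :: 'k ^ 3 \<Rightarrow> _)"
  proof (rule sympI)
    fix u v :: "'k ^ 3" assume "proj_rel u v"
    then obtain c where c: "u \<noteq> 0" "v \<noteq> 0" "c \<noteq> 0" and v: "v = c *s u"
      unfolding proj_rel_def by blast
    have "u = inverse c *s v" using c(3) by (simp only: v vector_smult_assoc) simp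
    then show "proj_rel v u" unfolding proj_rel_def
      using c by (intro conjI exI[of _ "inverse c"]) simp_all
  qed
  show "transp (proj_rel :: 'k ^ 3 \<Rightarrow> _)"
  proof (rule transpI)
    fix u v w :: "'k ^ 3" assume "proj_rel u v" "proj_rel v w"
    then obtain c d where c: "u \<noteq> 0" "w \<noteq> 0" "c \<noteq> 0" "d \<noteq> 0"
      and v: "v = c *s u" and w: "w = d *s v"
      unfolding proj_rel_def by blast
    have "w = (d * c) *s u" by (simp only: v w vector_smult_assoc)
    then show "proj_rel u w" unfolding proj_rel_def
      using c by (intro conjI exI[of _ "d * c"]) simp_all
  qed
qed

quotient_type (overloaded) 'k proj_plane = "'k::field ^ 3" / partial: proj_rel
  by (rule proj_rel_part_equivp)

text \<open>Vanishing at all homogeneous coordinate vectors of a point.\<close>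
lift_definition vanishes_at :: "'k::field poly3 \<Rightarrow> 'k proj_plane \<Rightarrow> bool"
  is "\<lambda>f v. \<forall>c. c \<noteq> 0 \<longrightarrow> eval3 f (c *s v) = 0"
proof -
  fix f :: "'k poly3" and u v :: "'k ^ 3"
  assume "proj_rel u v"
  then obtain c where c: "c \<noteq> 0" "v = c *s u" unfolding proj_rel_def by blast
  have u: "u = inverse c *s v" by (simp only: c vector_smult_assoc) (simp add: c(1))
  show "(\<forall>a. a \<noteq> 0 \<longrightarrow> eval3 f (a *s u) = 0) = (\<forall>a. a \<noteq> 0 \<longrightarrow> eval3 f (a *s v) = 0)"
  proof (intro iffI allI impI)
    fix a :: 'k assume H: "\<forall>a. a \<noteq> 0 \<longrightarrow> eval3 f (a *s u) = 0" and a: "a \<noteq> 0"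
    have "a * c \<noteq> 0" using a c(1) by simp
    with H have "eval3 f ((a * c) *s u) = 0" by blast
    then show "eval3 f (a *s v) = 0" by (simp only: c(2) vector_smult_assoc)
  next
    fix a :: 'k assume H: "\<forall>a. a \<noteq> 0 \<longrightarrow> eval3 f (a *s v) = 0" and a: "a \<noteq> 0"
    have "a * inverse c \<noteq> 0" using a c(1) by simp
    with H have "eval3 f ((a * inverse c) *s v) = 0" by blast
    then show "eval3 f (a *s u) = 0" by (subst u) (simp only: vector_smult_assoc)
  qed
qed

definition point_ideal :: "'k::field proj_plane \<Rightarrow> 'k poly3 set" where
  "point_ideal P = ideal_gen {f. (\<exists>d. f \<in> homogeneous_part d) \<and> vanishes_at f P}"

lift_definition incident :: "'k::field ^ 3 \<Rightarrow> 'k proj_plane \<Rightarrow> bool"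
  is "\<lambda>a v. (\<Sum>i\<in>UNIV. a $ i * v $ i) = 0"
proof -
  fix a u v :: "'k ^ 3"
  assume "proj_rel u v"
  then obtain c where c: "c \<noteq> 0" "v = c *s u" unfolding proj_rel_def by blast
  have "(\<Sum>i\<in>UNIV. a $ i * v $ i) = c * (\<Sum>i\<in>UNIV. a $ i * u $ i)"
    by (simp add: c sum_distrib_left mult_ac)
  then show "((\<Sum>i\<in>UNIV. a $ i * u $ i) = 0) = ((\<Sum>i\<in>UNIV. a $ i * v $ i) = 0)"
    using c(1) by simp
qed

definition is_line :: "'k::field proj_plane set \<Rightarrow> bool" where
  "is_line L \<longleftrightarrow> (\<exists>a. a \<noteq> 0 \<and> L = {P. incident a P})"

text \<open>
  A set of fat points \<open>m\<^sub>1 P\<^sub>1 + \<dots> + m\<^sub>s P\<^sub>s\<close> is encoded as the multiset containing each \<open>P\<^sub>i\<close> with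
  multiplicity \<open>m\<^sub>i\<close>.
\<close>
type_synonym 'k fat_points = "'k proj_plane multiset"

definition fat_ideal :: "'k::field fat_points \<Rightarrow> 'k poly3 set" where
  "fat_ideal Z = (\<Inter>P\<in>set_mset Z. ideal_pow (point_ideal P) (count Z P))"

definition reduced_points :: "'k::field fat_points \<Rightarrow> 'k proj_plane set" where
  "reduced_points Z = {P. count Z P = 1}"

definition double_points :: "'k::field fat_points \<Rightarrow> 'k proj_plane set" where
  "double_points Z = {P. count Z P = 2}"


section \<open>Valid Hilbert functions\<close>

text \<open>The list \<open>h\<close> is \<open>(h\<^sub>0, \<dots>, h\<^sub>\<sigma>)\<close>, so that \<open>\<sigma> + 1 = length h\<close>.\<close>
definition valid_hilbert :: "nat list \<Rightarrow> nat \<Rightarrow> bool" where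
  "valid_hilbert h \<alpha> \<longleftrightarrow> length h \<ge> 2 \<and> (\<forall>x\<in>set h. x > 0) \<and> 1 \<le> \<alpha> \<and> \<alpha> \<le> length h \<and>
     (\<forall>i<\<alpha>. h ! i = i + 1) \<and>
     (\<forall>i. \<alpha> \<le> i \<and> i < length h \<longrightarrow> h ! i \<le> \<alpha>) \<and>
     (\<forall>i j. \<alpha> \<le> i \<and> i \<le> j \<and> j < length h \<longrightarrow> h ! j \<le> h ! i)"

definition sum_hilbert :: "nat list \<Rightarrow> nat \<Rightarrow> nat" where
  "sum_hilbert h i = (\<Sum>j\<le>i. if j < length h then h ! j else 0)"

definition conjugate :: "nat list \<Rightarrow> nat \<Rightarrow> nat" where
  "conjugate h i = card {j. j < length h \<and> h ! j \<ge> i}"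


section \<open>The procedure\<close>

text \<open>Lines \<open>l 1, \<dots>, l \<alpha>\<close>, pairwise distinct, no three of which are concurrent.\<close>
definition general_lines :: "nat \<Rightarrow> (nat \<Rightarrow> 'k::field proj_plane set) \<Rightarrow> bool" where
  "general_lines \<alpha> l \<longleftrightarrow> (\<forall>i\<in>{1..\<alpha>}. is_line (l i)) \<and> inj_on l {1..\<alpha>} \<and>
     (\<forall>i\<in>{1..\<alpha>}. \<forall>j\<in>{1..\<alpha>}. \<forall>k\<in>{1..\<alpha>}. i \<noteq> j \<and> j \<noteq> k \<and> i \<noteq> k \<longrightarrow> l i \<inter> l j \<inter> l k = {})"

definition crossing :: "(nat \<Rightarrow> 'k::field proj_plane set) \<Rightarrow> nat \<Rightarrow> nat \<Rightarrow> 'k proj_plane" where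
  "crossing l i j = the_elem (l i \<inter> l j)"

definition initial :: "nat list \<Rightarrow> nat \<Rightarrow> (nat \<Rightarrow> 'k::field proj_plane set) \<Rightarrow> 'k fat_points \<Rightarrow> bool" where
  "initial h \<alpha> l Z \<longleftrightarrow> (\<exists>X. finite X \<and> Z = mset_set X \<and> X \<subseteq> (\<Union>i\<in>{1..\<alpha>}. l i) \<and>
     (\<forall>i\<in>{1..\<alpha>}. card (X \<inter> l i) = conjugate h i) \<and>
     (\<forall>i\<in>{1..\<alpha>}. \<forall>j\<in>{1..\<alpha>}. i \<noteq> j \<longrightarrow> X \<inter> (l i \<inter> l j) = {}))"

definition s_par :: "nat list \<Rightarrow> nat \<Rightarrow> nat \<Rightarrow> nat" where
  "s_par h \<alpha> n = card {k. n + 1 \<le> k \<and> k \<le> \<alpha> \<and> conjugate h k \<ge> n}"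

text \<open>The truncated subtraction of natural numbers is the positive part (for \<open>n \<ge> 1\<close>).\<close>
definition t_par :: "nat list \<Rightarrow> nat \<Rightarrow> nat \<Rightarrow> nat" where
  "t_par h \<alpha> n = min ((conjugate h n - (n - 1)) div 2) (s_par h \<alpha> n)"

text \<open>
  \<open>step h \<alpha> l n Z Z'\<close>: step \<open>n\<close>, started in \<open>Z\<close>, does not return, and can result in \<open>Z'\<close>.
  Here \<open>A\<close> is the set of points removed on the \<open>n\<close>-th line, and \<open>p j\<close> the one removed on the \<open>j\<close>-th.
\<close>
definition step :: "nat list \<Rightarrow> nat \<Rightarrow> (nat \<Rightarrow> 'k::field proj_plane set) \<Rightarrow> nat \<Rightarrow>
    'k fat_points \<Rightarrow> 'k fat_points \<Rightarrow> bool" where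
  "step h \<alpha> l n Z Z' \<longleftrightarrow> s_par h \<alpha> n \<noteq> 0 \<and>
     (let J = {n + 1..n + t_par h \<alpha> n} in
       \<exists>A p. A \<subseteq> reduced_points Z \<inter> l n \<and> card A = 2 * t_par h \<alpha> n \<and>
         (\<forall>j\<in>J. p j \<in> reduced_points Z \<inter> l j) \<and> inj_on p J \<and> A \<inter> p ` J = {} \<and>
         Z' = Z - mset_set (A \<union> p ` J) + (\<Sum>j\<in>J. replicate_mset 2 (crossing l n j)))"

text \<open>\<open>reachable h \<alpha> l Z\<^sub>0 n Z\<close>: some run starting from \<open>Z\<^sub>0\<close> gets to the end of step \<open>n\<close> with \<open>Z\<^sub>n = Z\<close>.\<close>
inductive reachable :: "nat list \<Rightarrow> nat \<Rightarrow> (nat \<Rightarrow> 'k::field proj_plane set) \<Rightarrow> 'k fat_points \<Rightarrow>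
    nat \<Rightarrow> 'k fat_points \<Rightarrow> bool" for h \<alpha> l Z\<^sub>0 where
  "reachable h \<alpha> l Z\<^sub>0 0 Z\<^sub>0"
| "reachable h \<alpha> l Z\<^sub>0 n Z \<Longrightarrow> step h \<alpha> l (n + 1) Z Z' \<Longrightarrow> reachable h \<alpha> l Z\<^sub>0 (n + 1) Z'"

definition outputs :: "nat list \<Rightarrow> nat \<Rightarrow> (nat \<Rightarrow> 'k::field proj_plane set) \<Rightarrow> 'k fat_points \<Rightarrow>
    'k fat_points \<Rightarrow> bool" where
  "outputs h \<alpha> l Z\<^sub>0 Z \<longleftrightarrow> (\<exists>n. reachable h \<alpha> l Z\<^sub>0 n Z \<and> s_par h \<alpha> (n + 1) = 0)"

end

theory Submission
  imports Defs
begin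

text \<open>
  The \<^emph>\<open>reduction vector\<close> of a fat point scheme \<open>Z\<close> along distinct lines \<open>\<ell>\<^sub>1, \<dots>, \<ell>\<^sub>r\<close> consists of the
  degrees \<open>d\<^sub>i\<close> of the intersection of \<open>\<ell>\<^sub>i\<close> with the scheme that is left of \<open>Z\<close> after taking residuals
  with respect to \<open>\<ell>\<^sub>1, \<dots>, \<ell>\<^bsub>i-1\<^esub>\<close>; the residual with respect to a line lowers the multiplicity of each
  point on that line by one. If nothing is left at the end and \<open>d\<^sub>1 > \<dots> > d\<^sub>r\<close>, then the reduction vector
  determines the Hilbert function: \<open>H\<^sub>Z(t) = \<Sum>\<^sub>i min (t + 2 - i) d\<^sub>i\<close>, where negative terms count as zero
  (a case of a theorem of Cooper, Harbourne and Teitler, \<open>hilbert_fun_reduction\<close>).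

  The sum is a lower bound since forms can be tested line by line (\<open>indep_mod_reduction\<close>): a multiple
  of \<open>\<ell>\<^sub>1 \<cdots> \<ell>\<^bsub>i-1\<^esub>\<close> of degree \<open>t\<close> has a cofactor of degree \<open>t + 1 - i\<close>, whose restriction to \<open>\<ell>\<^sub>i\<close> is a
  polynomial in one variable that must have \<open>d\<^sub>i\<close> zeros, counted with multiplicity. It is an upper
  bound (\<open>spans_mod_reduction\<close>) because of two estimates. Restriction to \<open>\<ell>\<^sub>1\<close> gives at most \<open>t + 1\<close>
  conditions in addition to those of the residual scheme, and this is the first term of the sum as
  long as \<open>t + 1 \<le> d\<^sub>1\<close>. For larger \<open>t\<close> the strict decrease turns every minimum into \<open>d\<^sub>i\<close>, and the sum
  becomes the degree of \<open>Z\<close>, which bounds the number of conditions imposed by \<open>Z\<close> in every degree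
  (\<open>spans_fat_degree\<close>).

  The conjugate of a valid Hilbert function is strictly decreasing, and for \<open>d\<^sub>i = h\<^sub>i\<^sup>\<star>\<close> the sum is \<open>H\<close>
  (\<open>line_sum_conjugate\<close>). It remains to see that every \<open>Z\<^sub>n\<close> has reduction vector \<open>\<Delta>H\<^sup>\<star>\<close>. This holds for
  \<open>Z\<^sub>0\<close>. A double point \<open>2P\<^bsub>n,j\<^esub>\<close> with \<open>n < j\<close> contributes two to the entry of \<open>\<ell>\<^sub>n\<close>, and after the residual
  with respect to \<open>\<ell>\<^sub>n\<close> it contributes one to the entry of \<open>\<ell>\<^sub>j\<close>; so step \<open>n\<close> removes exactly as many
  reduced points from each line as are needed to keep the vector (\<open>balanced_step\<close>). The required
  points are available since each earlier step has taken at most one point from a line that is still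
  to be processed, while \<open>t\<^sub>n\<close> is bounded by \<open>(h\<^sub>n\<^sup>\<star> - (n - 1)) / 2\<close> and the lines concerned satisfy
  \<open>h\<^sub>j\<^sup>\<star> \<ge> n\<close> (\<open>balanced_step_exists\<close>).
\<close>


section \<open>Dimension bounds for quotients\<close>

context smul_space
begin

text \<open>Codimensions are computed from both sides: \<open>spans_mod\<close> bounds the dimension of \<open>V / W\<close> from above,
  and \<open>indep_mod\<close> bounds it from below.\<close>
definition spans_mod :: "'b set \<Rightarrow> 'b set \<Rightarrow> nat \<Rightarrow> bool" where
  "spans_mod V W n \<longleftrightarrow>
     (\<exists>B. finite B \<and> card B \<le> n \<and> B \<subseteq> V \<and> (\<forall>v\<in>V. \<exists>b\<in>span B. v - b \<in> W))"

definition indep_mod :: "'b set \<Rightarrow> 'b set \<Rightarrow> nat \<Rightarrow> bool" where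
  "indep_mod V W n \<longleftrightarrow> (\<exists>u :: nat \<Rightarrow> 'b. (\<forall>i<n. u i \<in> V) \<and>
     (\<forall>c. (\<Sum>i<n. smul (c i) (u i)) \<in> W \<longrightarrow> (\<forall>i<n. c i = 0)))"

lemma spans_modI:
  assumes "finite B" "card B \<le> n" "B \<subseteq> V" "subspace W" "V \<subseteq> span (B \<union> C)" "C \<subseteq> W"
  shows "spans_mod V W n"
proof -
  have "\<exists>b\<in>span B. v - b \<in> W" if "v \<in> V" for v
  proof -
    have "v \<in> span (B \<union> C)" using that assms(5) by blast
    then obtain b d where bd: "v = b + d" "b \<in> span B" "d \<in> span C"
      unfolding span_Un by blast
    have "d \<in> W" using bd(3) span_minimal[OF assms(6,4)] by blast
    then show ?thesis using bd by (intro bexI[of _ b]) auto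
  qed
  then show ?thesis unfolding spans_mod_def using assms(1-3) by blast
qed

lemma spans_mod_trans:
  assumes "spans_mod U V m" "spans_mod V W n" "V \<subseteq> U"
  shows "spans_mod U W (m + n)"
proof -
  obtain B where B: "finite B" "card B \<le> m" "B \<subseteq> U" "\<And>v. v \<in> U \<Longrightarrow> \<exists>b\<in>span B. v - b \<in> V"
    using assms(1) unfolding spans_mod_def by blast
  obtain C where C: "finite C" "card C \<le> n" "C \<subseteq> V" "\<And>v. v \<in> V \<Longrightarrow> \<exists>b\<in>span C. v - b \<in> W"
    using assms(2) unfolding spans_mod_def by blast
  have "\<exists>b\<in>span (B \<union> C). u - b \<in> W" if u: "u \<in> U" for u
  proof -
    obtain b where b: "b \<in> span B" "u - b \<in> V" using B(4)[OF u] by blast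
    obtain c where c: "c \<in> span C" "u - b - c \<in> W" using C(4)[OF b(2)] by blast
    have "b + c \<in> span (B \<union> C)" unfolding span_Un using b c by blast
    then show ?thesis using c(2) by (intro bexI[of _ "b + c"]) (auto simp: algebra_simps)
  qed
  moreover have "card (B \<union> C) \<le> m + n" using card_Un_le[of B C] B(2) C(2) by linarith
  ultimately show ?thesis unfolding spans_mod_def
    using B C assms(3) by (intro exI[of _ "B \<union> C"]) auto
qed

lemma spans_mod_dim:
  assumes "spans_mod V W n" "subspace W" "W \<subseteq> V" "finite F" "V \<subseteq> span F"
  shows "dim V \<le> n + dim W"
proof -
  obtain B where B: "finite B" "card B \<le> n" "\<And>v. v \<in> V \<Longrightarrow> \<exists>b\<in>span B. v - b \<in> W"
    using assms(1) unfolding spans_mod_def by blast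
  obtain C where C: "C \<subseteq> W" "independent C" "W \<subseteq> span C" "card C = dim W"
    using basis_exists by blast
  have finC: "finite C"
    using independent_span_bound[OF assms(4) C(2)] C(1) assms(3,5) by blast
  have "V \<subseteq> span (B \<union> C)"
  proof
    fix v assume "v \<in> V"
    then obtain b where b: "b \<in> span B" "v - b \<in> W" using B(3) by blast
    then have "v - b \<in> span C" using C(3) by blast
    then have "b + (v - b) \<in> span (B \<union> C)" unfolding span_Un using b by blast
    then show "v \<in> span (B \<union> C)" by simp
  qed
  then have "dim V \<le> card (B \<union> C)" using B(1) finC by (intro dim_le_card) auto
  also have "\<dots> \<le> n + dim W" using card_Un_le[of B C] B(2) C(4) by linarith
  finally show ?thesis .
qed

lemma indep_mod_dim:
  assumes "indep_mod V W n" "subspace V" "subspace W" "W \<subseteq> V" "finite F" "V \<subseteq> span F"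
  shows "n + dim W \<le> dim V"
proof -
  obtain u where u: "\<And>i. i < n \<Longrightarrow> u i \<in> V"
      "\<And>c. (\<Sum>i<n. smul (c i) (u i)) \<in> W \<Longrightarrow> \<forall>i<n. c i = 0"
    using assms(1) unfolding indep_mod_def by blast
  define B where "B = u ` {..<n}"
  have inj: "inj_on u {..<n}"
  proof (rule inj_onI, rule ccontr)
    fix i j assume ij: "i \<in> {..<n}" "j \<in> {..<n}" "u i = u j" "i \<noteq> j"
    \<comment> \<open>If \<open>u i = u j\<close>, then the difference of the two is a relation modulo \<open>W\<close>.\<close>
    define c where "c k = (if k = i then 1 else if k = j then -1 else 0 :: 'a)" for k
    have "(\<Sum>k<n. smul (c k) (u k)) = (\<Sum>k\<in>{i,j}. smul (c k) (u k))"
      using ij by (intro sum.mono_neutral_right) (auto simp: c_def)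
    also have "\<dots> = 0" using ij by (simp add: c_def)
    finally have "\<forall>k<n. c k = 0" using u(2) subspace_0[OF assms(3)] by simp
    then show False using ij by (auto simp: c_def split: if_splits)
  qed
  define V' where "V' = span (B \<union> W)"
  have BV: "B \<subseteq> V" using u(1) by (auto simp: B_def)
  have sub: "V' \<subseteq> V" unfolding V'_def using BV assms(2,4) by (intro span_minimal) auto
  have "quotient_basis smul V' W B"
    unfolding quotient_basis_def
  proof (intro conjI allI impI ballI)
    show "finite B" by (simp add: B_def)
    show "B \<subseteq> V'" by (auto simp: V'_def intro: span_base)
  next
    fix c b assume c: "(\<Sum>b\<in>B. smul (c b) b) \<in> W" and b: "b \<in> B"
    have "(\<Sum>b\<in>B. smul (c b) b) = (\<Sum>i<n. smul (c (u i)) (u i))"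
      unfolding B_def by (subst sum.reindex[OF inj]) simp
    with c u(2)[of "\<lambda>i. c (u i)"] b show "c b = 0" by (auto simp: B_def)
  next
    fix v assume "v \<in> V'"
    then obtain b w where v: "v = b + w" "b \<in> span B" "w \<in> span W"
      unfolding V'_def span_Un by blast
    obtain c where "b = (\<Sum>x\<in>B. smul (c x) x)"
      using v(2) span_finite[of B] by (auto simp: B_def)
    moreover have "w \<in> W" using v(3) assms(3) by (simp add: span_eq_iff[THEN iffD2])
    ultimately show "\<exists>c. v - (\<Sum>b\<in>B. smul (c b) b) \<in> W" using v(1) by (intro exI[of _ c]) simp
  qed
  moreover have "W \<subseteq> V'" by (auto simp: V'_def intro: span_base)
  moreover have "V' \<subseteq> span F" using sub assms(6) by blast
  ultimately have "card B + dim W = dim V'"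
    using quotient_basis_card[OF assms(3) _ _ assms(5), of V'] by (simp add: V'_def del: dim_span)
  moreover have "dim V' \<le> dim V"
  proof -
    obtain D where D: "D \<subseteq> V" "independent D" "V \<subseteq> span D" "card D = dim V"
      using basis_exists by blast
    have "finite D" using independent_span_bound[OF assms(5) D(2)] D(1) assms(6) by blast
    then show ?thesis using dim_le_card[of V' D] sub D by auto
  qed
  moreover have "card B = n" by (simp add: B_def card_image[OF inj])
  ultimately show ?thesis by simp
qed

lemma quotient_dim_eqI:
  assumes "spans_mod V W n" "indep_mod V W n" "subspace V" "subspace W" "W \<subseteq> V"
    "finite F" "V \<subseteq> span F"
  shows "quotient_dim smul V W = n"
  using spans_mod_dim[OF assms(1,4-7)] indep_mod_dim[OF assms(2,3-7)]
    quotient_dim_eq[OF assms(4,3,5-7)] by simp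

lemma indep_mod_mono_sub:
  assumes "indep_mod V W n" "W' \<subseteq> W" shows "indep_mod V W' n"
proof -
  obtain u where "\<forall>i<n. u i \<in> V"
      "\<And>c. (\<Sum>i<n. smul (c i) (u i)) \<in> W \<Longrightarrow> \<forall>i<n. c i = 0"
    using assms(1) unfolding indep_mod_def by blast
  then show ?thesis unfolding indep_mod_def using assms(2) by (intro exI[of _ u]) auto
qed

text \<open>The quotient \<open>U / (U \<inter> W)\<close> embeds into \<open>V / W\<close>: a basis of the former stays independent modulo
  \<open>W\<close>, so its size is bounded by any number of generators of the latter.\<close>
lemma spans_mod_subspace:
  assumes "spans_mod V W n" "subspace U" "U \<subseteq> V" "subspace V" "subspace W" "W \<subseteq> V"
    "finite F" "V \<subseteq> span F"
  shows "spans_mod U (U \<inter> W) n"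
proof -
  have "subspace (U \<inter> W)" using assms(2,5) by (rule subspace_inter)
  moreover have "U \<subseteq> span F" using assms(3,8) by blast
  ultimately obtain B where B: "quotient_basis smul U (U \<inter> W) B"
    using quotient_basis_exists[OF _ assms(2) _ assms(7)] by blast
  then have finB: "finite B" and BU: "B \<subseteq> U"
    and ind: "\<And>c. (\<Sum>b\<in>B. smul (c b) b) \<in> U \<inter> W \<Longrightarrow> \<forall>b\<in>B. c b = 0"
    and gen: "\<And>v. v \<in> U \<Longrightarrow> \<exists>c. v - (\<Sum>b\<in>B. smul (c b) b) \<in> U \<inter> W"
    unfolding quotient_basis_def by blast+
  obtain e where e: "bij_betw e {..<card B} B"
    using ex_bij_betw_nat_finite[OF finB] by (auto simp: atLeast0LessThan)
  have "indep_mod V W (card B)"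
    unfolding indep_mod_def
  proof (intro exI[of _ e] conjI allI impI)
    show "e i \<in> V" if "i < card B" for i
      using bij_betw_apply[OF e] that BU assms(3) by auto
  next
    fix c i assume c: "(\<Sum>i<card B. smul (c i) (e i)) \<in> W" and i: "i < card B"
    let ?c = "c \<circ> inv_into {..<card B} e"
    have "(\<Sum>b\<in>B. smul (?c b) b) = (\<Sum>i<card B. smul (?c (e i)) (e i))"
      by (rule sum.reindex_bij_betw[OF e, symmetric])
    also have "\<dots> = (\<Sum>i<card B. smul (c i) (e i))"
      by (intro sum.cong) (use e in \<open>auto simp: bij_betw_inv_into_left\<close>)
    finally have "(\<Sum>b\<in>B. smul (?c b) b) \<in> W" using c by simp
    moreover have "(\<Sum>b\<in>B. smul (?c b) b) \<in> U"
      using BU assms(2) by (intro subspace_sum subspace_scale) auto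
    ultimately have "?c (e i) = 0" using ind[of ?c] bij_betw_apply[OF e] i by auto
    then show "c i = 0" using e i by (simp add: bij_betw_inv_into_left)
  qed
  from indep_mod_dim[OF this assms(4-8)] spans_mod_dim[OF assms(1,5-8)]
  have "card B \<le> n" by simp
  moreover have "\<exists>b\<in>span B. v - b \<in> U \<inter> W" if v: "v \<in> U" for v
  proof -
    obtain c where "v - (\<Sum>b\<in>B. smul (c b) b) \<in> U \<inter> W" using gen[OF v] by blast
    then show ?thesis
      by (intro bexI[of _ "\<Sum>b\<in>B. smul (c b) b"] span_sum span_scale span_base) auto
  qed
  ultimately show ?thesis unfolding spans_mod_def using finB BU by blast
qed

text \<open>Conditions imposed at several places add up at most: each further subspace is cut with the
  intersection of the previous ones, where its codimension cannot have grown.\<close>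
lemma spans_mod_Inter:
  assumes "finite S" "subspace V" "finite F" "V \<subseteq> span F"
    and "\<And>x. x \<in> S \<Longrightarrow> subspace (W x)" "\<And>x. x \<in> S \<Longrightarrow> spans_mod V (V \<inter> W x) (n x)"
  shows "spans_mod V (V \<inter> (\<Inter>x\<in>S. W x)) (\<Sum>x\<in>S. n x)"
  using assms(1,5,6)
proof (induction S rule: finite_induct)
  case empty
  show ?case unfolding spans_mod_def by (rule exI[of _ "{}"]) auto
next
  case (insert x S)
  let ?U = "V \<inter> (\<Inter>x\<in>S. W x)"
  have U: "subspace ?U"
    using insert.prems(1) assms(2) by (intro subspace_inter subspace_Inter) auto
  have Wx: "subspace (V \<inter> W x)" using insert.prems(1) assms(2) by (intro subspace_inter) auto
  have "spans_mod V ?U (\<Sum>x\<in>S. n x)" using insert by auto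
  moreover have "spans_mod ?U (?U \<inter> (V \<inter> W x)) (n x)"
    using insert.prems(2)[of x] spans_mod_subspace[OF _ U _ assms(2) Wx _ assms(3,4)] by auto
  ultimately have "spans_mod V (?U \<inter> (V \<inter> W x)) ((\<Sum>x\<in>S. n x) + n x)"
    by (rule spans_mod_trans) auto
  moreover have "?U \<inter> (V \<inter> W x) = V \<inter> (\<Inter>x\<in>insert x S. W x)" by auto
  ultimately show ?case using insert.hyps by (simp add: add.commute)
qed

end


section \<open>Homogeneous polynomials and linear forms\<close>

lemma mdeg_0 [simp]: "mdeg 0 = 0"
  by (simp add: mdeg_def)

lemma mdeg_add: "mdeg (m + n) = mdeg m + mdeg n"
  by (simp add: mdeg_def lookup_add sum.distrib)

lemma mdeg_single: "mdeg (Poly_Mapping.single i k) = k"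
  by (simp add: mdeg_def lookup_single when_def)

lemma homogeneous_mult:
  "f \<in> homogeneous_part s \<Longrightarrow> g \<in> homogeneous_part t \<Longrightarrow> f * g \<in> homogeneous_part (s + t)"
  using keys_mult[of f g] by (fastforce simp: homogeneous_part_def mdeg_add)

lemma homogeneous_one: "1 \<in> homogeneous_part 0"
  by (simp add: homogeneous_part_def)

lemma homogeneous_power:
  "f \<in> homogeneous_part s \<Longrightarrow> f ^ n \<in> homogeneous_part (n * s)"
  by (induction n) (auto simp: homogeneous_one dest: homogeneous_mult)

lemma keys_scale3: "Poly_Mapping.keys (scale3 c f) \<subseteq> Poly_Mapping.keys f"
  unfolding scale3_def
  by (rule subset_trans[OF keys_mult]) (auto simp del: keys_single simp: in_keys_iff lookup_single when_def split: if_splits)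

lemma subspace_homogeneous: "poly3.subspace (homogeneous_part d)"
  unfolding poly3.subspace_def homogeneous_part_def
  using keys_scale3 keys_add by (fastforce dest: subsetD)

lemma poly_mapping_sum_single:
  fixes f :: "'a \<Rightarrow>\<^sub>0 'b::comm_monoid_add"
  shows "f = (\<Sum>m\<in>Poly_Mapping.keys f. Poly_Mapping.single m (Poly_Mapping.lookup f m))"
  by (rule poly_mapping_eqI) (simp add: lookup_sum lookup_single when_def in_keys_iff)

lemma scale3_single: "scale3 c (Poly_Mapping.single m d) = Poly_Mapping.single m (c * d)"
  by (simp add: scale3_def mult_single)

lemma scale3_mult_left: "scale3 c f * g = scale3 c (f * g)"
  by (simp add: scale3_def mult.assoc)

lemma scale3_mult_right: "f * scale3 c g = scale3 c (f * g)"
  by (simp add: scale3_def mult_ac)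

definition var3 :: "3 \<Rightarrow> 'k::field poly3" where
  "var3 i = Poly_Mapping.single (Poly_Mapping.single i 1) 1"

lemma var3_homogeneous: "var3 i \<in> homogeneous_part 1"
  by (simp add: var3_def homogeneous_part_def mdeg_single)

lemma homogeneous_induct:
  fixes f :: "'k::field poly3"
  assumes "f \<in> homogeneous_part t"
    and sub: "\<And>t. poly3.subspace (S t)" and one: "1 \<in> S 0"
    and var: "\<And>t f i. f \<in> S t \<Longrightarrow> var3 i * f \<in> S (Suc t)"
  shows "f \<in> S t"
proof -
  have mono: "Poly_Mapping.single m (1::'k) \<in> S (mdeg m)" for m
  proof (induction "mdeg m" arbitrary: m)
    case 0
    then have "m = 0" by (intro poly_mapping_eqI) (simp add: mdeg_def)
    then show ?case using one by simp
  next
    case (Suc n)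
    then obtain i where i: "Poly_Mapping.lookup m i \<noteq> 0"
      unfolding mdeg_def by (metis nat.simps(3) sum.neutral)
    define m' where "m' = m - Poly_Mapping.single i 1"
    have m: "m = Poly_Mapping.single i 1 + m'"
      using i by (intro poly_mapping_eqI)
        (auto simp: m'_def lookup_add lookup_minus lookup_single when_def)
    have "mdeg m' = n" using Suc.hyps(2) unfolding m by (simp add: mdeg_add mdeg_single)
    then have "Poly_Mapping.single m' 1 \<in> S n" using Suc.hyps(1) by blast
    from var[OF this, of i] show ?case
      using Suc.hyps(2) by (simp add: var3_def mult_single) (metis One_nat_def m)
  qed
  have "Poly_Mapping.single m (Poly_Mapping.lookup f m) \<in> S t" if "m \<in> Poly_Mapping.keys f" for m
  proof -
    have "mdeg m = t" using assms(1) that by (simp add: homogeneous_part_def)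
    then have "scale3 (Poly_Mapping.lookup f m) (Poly_Mapping.single m 1) \<in> S t"
      using mono[of m] sub by (intro poly3.subspace_scale) auto
    then show ?thesis by (simp add: scale3_single)
  qed
  then have "(\<Sum>m\<in>Poly_Mapping.keys f. Poly_Mapping.single m (Poly_Mapping.lookup f m)) \<in> S t"
    using sub by (intro poly3.subspace_sum)
  then show ?thesis using poly_mapping_sum_single[of f] by simp
qed

definition lin3 :: "'k::field ^ 3 \<Rightarrow> 'k poly3" where
  "lin3 c = (\<Sum>i\<in>UNIV. scale3 (c $ i) (var3 i))"

lemma lin3_homogeneous: "lin3 c \<in> homogeneous_part 1"
  unfolding lin3_def using subspace_homogeneous var3_homogeneous
  by (intro poly3.subspace_sum poly3.subspace_scale)

lemma lin3_power_homogeneous: "lin3 c ^ n \<in> homogeneous_part n"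
  using homogeneous_power[OF lin3_homogeneous, of c n] by simp

definition dot :: "'k::field ^ 3 \<Rightarrow> 'k ^ 3 \<Rightarrow> 'k" where
  "dot u v = (\<Sum>i\<in>UNIV. u $ i * v $ i)"

lemma dot_zero_right [simp]: "dot u 0 = 0"
  by (simp add: dot_def)

lemma dot_add_right: "dot u (v + w) = dot u v + dot u w"
  by (simp add: dot_def algebra_simps sum.distrib)

lemma dot_scale_right: "dot u (s *s v) = s * dot u v"
  by (simp add: dot_def algebra_simps sum_distrib_left)

text \<open>The vectors \<open>a, b, d\<close> form a basis of \<open>k\<^sup>3\<close> with dual basis \<open>y, z, c\<close>: restricted to the line
  \<open>c = 0\<close>, the forms \<open>y\<close> and \<open>z\<close> are coordinates with respect to \<open>a\<close> and \<open>b\<close>.\<close>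
definition frame :: "'k::field ^ 3 \<Rightarrow> 'k ^ 3 \<Rightarrow> 'k ^ 3 \<Rightarrow> 'k ^ 3 \<Rightarrow> 'k ^ 3 \<Rightarrow> 'k ^ 3 \<Rightarrow> bool" where
  "frame a b d y z c \<longleftrightarrow> (\<forall>w. w = dot y w *s a + dot z w *s b + dot c w *s d) \<and>
     dot y a = 1 \<and> dot z a = 0 \<and> dot c a = 0 \<and> dot y b = 0 \<and> dot z b = 1 \<and> dot c b = 0"

lemma frame_var3:
  fixes a :: "'k::field ^ 3"
  assumes "frame a b d y z c"
  shows "var3 i = scale3 (a $ i) (lin3 y) + scale3 (b $ i) (lin3 z) + scale3 (d $ i) (lin3 c)"
proof -
  have *: "y $ k * a $ i + z $ k * b $ i + c $ k * d $ i = (if k = i then 1 else 0)" for k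
  proof -
    have dot: "dot u (axis k 1) = u $ k" for u :: "'k ^ 3"
      by (simp add: dot_def axis_def if_distrib[of "(*) _"] cong: if_cong)
    have "axis k 1 = dot y (axis k 1) *s a + dot z (axis k 1) *s b + dot c (axis k 1) *s d"
      using assms unfolding frame_def by blast
    then have "axis k 1 $ i = (y $ k *s a + z $ k *s b + c $ k *s d) $ i"
      unfolding dot by metis
    then show ?thesis by (auto simp: axis_def)
  qed
  have "scale3 (a $ i) (lin3 y) + scale3 (b $ i) (lin3 z) + scale3 (d $ i) (lin3 c)
      = (\<Sum>k\<in>UNIV. scale3 (y $ k * a $ i + z $ k * b $ i + c $ k * d $ i) (var3 k))"
    by (simp add: lin3_def poly3.scale_sum_right poly3.scale_left_distrib sum.distrib mult.commute)
  also have "\<dots> = (\<Sum>k\<in>UNIV. if k = i then var3 k else 0)"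
    unfolding * by (intro sum.cong) auto
  also have "\<dots> = var3 i" by simp
  finally show ?thesis by simp
qed

definition frame_monomials :: "nat \<Rightarrow> 'k::field ^ 3 \<Rightarrow> 'k ^ 3 \<Rightarrow> 'k ^ 3 \<Rightarrow> 'k poly3 set" where
  "frame_monomials t y z c =
     (\<lambda>(j, k). lin3 y ^ (t - j - k) * lin3 z ^ j * lin3 c ^ k) ` {(j, k). j + k \<le> t}"

lemma finite_le_pairs: "finite {(j, k). j + k \<le> (t::nat)}"
  by (rule finite_subset[of _ "{..t} \<times> {..t}"]) auto

lemma frame_monomials_homogeneous: "frame_monomials t y z c \<subseteq> homogeneous_part t"
proof -
  have "lin3 y ^ (t - j - k) * lin3 z ^ j * lin3 c ^ k \<in> homogeneous_part t" if "j + k \<le> t" for j k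
    using homogeneous_mult[OF homogeneous_mult[OF lin3_power_homogeneous lin3_power_homogeneous]
        lin3_power_homogeneous, of y "t - j - k" z j c k] that by simp
  then show ?thesis by (auto simp: frame_monomials_def)
qed

lemma homogeneous_span_frame:
  fixes a :: "'k::field ^ 3"
  assumes "frame a b d y z c"
  shows "homogeneous_part t \<subseteq> poly3.span (frame_monomials t y z c)"
proof
  fix f :: "'k poly3" assume f: "f \<in> homogeneous_part t"
  show "f \<in> poly3.span (frame_monomials t y z c)"
  proof (rule homogeneous_induct[where S = "\<lambda>t. poly3.span (frame_monomials t y z c)", OF f])
    show "1 \<in> poly3.span (frame_monomials 0 y z c)"
      by (rule poly3.span_base) (auto simp: frame_monomials_def image_iff)
  next
    fix t i and f :: "'k poly3" assume f: "f \<in> poly3.span (frame_monomials t y z c)"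
    let ?T = "{g. var3 i * g \<in> poly3.span (frame_monomials (Suc t) y z c)}"
    have "poly3.subspace ?T"
      by (auto simp: poly3.subspace_def distrib_left scale3_mult_right poly3.span_zero
          poly3.span_add poly3.span_scale)
    moreover have "frame_monomials t y z c \<subseteq> ?T"
    proof
      fix g assume "g \<in> frame_monomials t y z c"
      then obtain j k where jk: "j + k \<le> t"
        and g: "g = lin3 y ^ (t - j - k) * lin3 z ^ j * lin3 c ^ k"
        by (auto simp: frame_monomials_def)
      have mem: "lin3 y ^ (Suc t - j - k) * lin3 z ^ j * lin3 c ^ k
          \<in> poly3.span (frame_monomials (Suc t) y z c)" if "j + k \<le> Suc t" for j k
        using that by (intro poly3.span_base) (auto simp: frame_monomials_def image_iff)
      have "Suc t - j - k = Suc (t - j - k)" using jk by simp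
      then have "lin3 y * g \<in> poly3.span (frame_monomials (Suc t) y z c)"
        using mem[of j k] jk unfolding g by (simp add: mult_ac)
      moreover have "lin3 z * g \<in> poly3.span (frame_monomials (Suc t) y z c)"
        using mem[of "Suc j" k] jk unfolding g by (simp add: mult_ac)
      moreover have "lin3 c * g \<in> poly3.span (frame_monomials (Suc t) y z c)"
        using mem[of j "Suc k"] jk unfolding g by (simp add: mult_ac)
      ultimately show "g \<in> ?T" unfolding frame_var3[OF assms, of i]
        by (simp add: distrib_right scale3_mult_left poly3.span_add poly3.span_scale)
    qed
    ultimately have "poly3.span (frame_monomials t y z c) \<subseteq> ?T" by (intro poly3.span_minimal)
    then show "var3 i * f \<in> poly3.span (frame_monomials (Suc t) y z c)" using f by blast
  qed simp
qed

section \<open>Restriction to a line\<close>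

text \<open>Restriction to the line through \<open>a\<close> and \<open>b\<close>, in the affine coordinate in which \<open>a\<close> is the origin and
  \<open>b\<close> is the point at infinity.\<close>
definition restr :: "'k::field ^ 3 \<Rightarrow> 'k ^ 3 \<Rightarrow> 'k poly3 \<Rightarrow> 'k poly" where
  "restr a b f = (\<Sum>m\<in>Poly_Mapping.keys f. smult (Poly_Mapping.lookup f m)
     (\<Prod>i\<in>UNIV. [:a $ i, b $ i:] ^ Poly_Mapping.lookup m i))"

lemma restr_superset:
  assumes "finite A" "Poly_Mapping.keys f \<subseteq> A"
  shows "restr a b f = (\<Sum>m\<in>A. smult (Poly_Mapping.lookup f m)
     (\<Prod>i\<in>UNIV. [:a $ i, b $ i:] ^ Poly_Mapping.lookup m i))"
  unfolding restr_def using assms by (intro sum.mono_neutral_left) (auto simp: in_keys_iff)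

lemma restr_0 [simp]: "restr a b 0 = 0"
  by (simp add: restr_def)

lemma restr_add: "restr a b (f + g) = restr a b f + restr a b g"
proof -
  let ?A = "Poly_Mapping.keys f \<union> Poly_Mapping.keys g"
  show ?thesis
    using keys_add[of f g]
    by (simp add: restr_superset[of ?A] lookup_add smult_add_left sum.distrib)
qed

lemma restr_sum: "restr a b (\<Sum>x\<in>A. f x) = (\<Sum>x\<in>A. restr a b (f x))"
  by (induction A rule: infinite_finite_induct) (auto simp: restr_add)

lemma restr_single: "restr a b (Poly_Mapping.single m s) =
    smult s (\<Prod>i\<in>UNIV. [:a $ i, b $ i:] ^ Poly_Mapping.lookup m i)"
  by (subst restr_superset[of "{m}"]) auto

lemma restr_mult: "restr a b (f * g) = restr a b f * restr a b g"
proof -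
  have single: "restr a b (Poly_Mapping.single m s * Poly_Mapping.single n r)
      = restr a b (Poly_Mapping.single m s) * restr a b (Poly_Mapping.single n r)" for m n s r
    by (simp add: mult_single restr_single lookup_add power_add prod.distrib mult_ac)
  let ?f = "\<lambda>f m. Poly_Mapping.single m (Poly_Mapping.lookup f m)"
  have "restr a b ((\<Sum>m\<in>Poly_Mapping.keys f. ?f f m) * (\<Sum>n\<in>Poly_Mapping.keys g. ?f g n))
      = restr a b (\<Sum>m\<in>Poly_Mapping.keys f. ?f f m) * restr a b (\<Sum>n\<in>Poly_Mapping.keys g. ?f g n)"
    by (simp only: sum_product restr_sum single)
  then show ?thesis by (simp only: poly_mapping_sum_single[symmetric])
qed

lemma restr_1 [simp]: "restr a b 1 = 1"
  by (simp add: restr_single single_one[symmetric] del: single_one)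

lemma restr_power: "restr a b (f ^ n) = restr a b f ^ n"
  by (induction n) (auto simp: restr_mult)

lemma restr_scale3: "restr a b (scale3 s f) = smult s (restr a b f)"
  by (simp add: scale3_def restr_mult restr_single)

lemma restr_var3: "restr a b (var3 i) = [:a $ i, b $ i:]"
proof -
  have "(\<Prod>j\<in>UNIV. [:a $ j, b $ j:] ^ Poly_Mapping.lookup (Poly_Mapping.single i (1::nat)) j)
      = (\<Prod>j\<in>UNIV. if j = i then [:a $ j, b $ j:] else 1)"
    by (intro prod.cong) (auto simp: lookup_single when_def)
  then show ?thesis by (simp add: var3_def restr_single)
qed

lemma restr_lin3: "restr a b (lin3 c) = [:dot c a, dot c b:]"
proof -
  have "(\<Sum>i\<in>A. [:f i, g i:]) = [:\<Sum>i\<in>A. f i, \<Sum>i\<in>A. g i:]" for A and f g :: "3 \<Rightarrow> 'a"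
    by (induction A rule: infinite_finite_induct) auto
  then show ?thesis
    by (simp add: lin3_def restr_sum restr_scale3 restr_var3 dot_def)
qed

lemma poly_restr: "poly (restr a b f) x = eval3 f (a + x *s b)"
  by (simp add: restr_def eval3_def poly_sum poly_prod mult.commute)

lemma eval3_lin3: "eval3 (lin3 c) v = dot c v"
  using poly_restr[of v 0 "lin3 c" 0] by (simp add: restr_lin3)


section \<open>Points and frames\<close>

abbreviation pt :: "'k::field ^ 3 \<Rightarrow> 'k proj_plane" where
  "pt \<equiv> abs_proj_plane"

lemma rep_nonzero: "rep_proj_plane P \<noteq> 0"
  using Quotient_rep_reflp[OF Quotient_proj_plane, of P] by (simp add: proj_rel_def)

lemma pt_rep [simp]: "pt (rep_proj_plane P) = P"
  by (rule Quotient_abs_rep[OF Quotient_proj_plane])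

lemma proj_rel_refl: "proj_rel v v \<longleftrightarrow> v \<noteq> 0"
  unfolding proj_rel_def by (auto intro: exI[of _ 1])

lemma pt_eq_iff: "v \<noteq> 0 \<Longrightarrow> w \<noteq> 0 \<Longrightarrow> pt v = pt w \<longleftrightarrow> (\<exists>s. s \<noteq> 0 \<and> w = s *s v)"
  using Quotient_rel[OF Quotient_proj_plane, of v w] unfolding proj_rel_refl
  by (auto simp: proj_rel_def)

lemma incident_pt: "v \<noteq> 0 \<Longrightarrow> incident c (pt v) \<longleftrightarrow> dot c v = 0"
  by (simp add: incident.abs_eq proj_rel_refl dot_def)

lemma incident_rep: "incident c P \<longleftrightarrow> dot c (rep_proj_plane P) = 0"
  by (simp add: incident.rep_eq dot_def)

lemma vanishes_at_pt: "v \<noteq> 0 \<Longrightarrow> vanishes_at f (pt v) \<longleftrightarrow> (\<forall>s. s \<noteq> 0 \<longrightarrow> eval3 f (s *s v) = 0)"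
  by (simp add: vanishes_at.abs_eq proj_rel_refl)

lemma nonzero_coordinate:
  fixes v :: "'k::field ^ 3"
  assumes "v \<noteq> 0"
  obtains j p q where "v $ j \<noteq> 0" "j \<noteq> p" "j \<noteq> q" "p \<noteq> q" "UNIV = {j, p, q}"
proof -
  obtain j where j: "v $ j \<noteq> 0" using assms by (auto simp: vec_eq_iff)
  have "card (UNIV - {j}) = 2" by simp
  then obtain p q where pq: "UNIV - {j} = {p, q}" "p \<noteq> q" by (meson card_2_iff)
  show thesis by (rule that[OF j _ _ pq(2)]) (use pq in auto)
qed

text \<open>If the coordinate \<open>v\<^sub>j\<close> does not vanish, then \<open>v\<close> and the two other unit vectors form a basis.\<close>
lemma frame_point:
  fixes v :: "'k::field ^ 3"
  assumes "v \<noteq> 0"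
  obtains b d y z c where "frame v b d y z c"
proof -
  obtain j p q where j: "v $ j \<noteq> 0" and jpq: "j \<noteq> p" "j \<noteq> q" "p \<noteq> q"
    and U: "UNIV = {j, p, q}" using nonzero_coordinate[OF assms] .
  have all: "(\<forall>i. P i) \<longleftrightarrow> P j \<and> P p \<and> P q" for P using U by (metis UNIV_I empty_iff insert_iff)
  have sum: "(\<Sum>i\<in>UNIV. f i) = f j + f p + f q" for f :: "3 \<Rightarrow> 'k"
    unfolding U using jpq by (simp add: add.assoc)
  define y where "y = (\<chi> i. if i = j then 1 / v $ j else 0)"
  define z where "z = (\<chi> i. if i = p then 1 else if i = j then - v $ p / v $ j else 0)"
  define c where "c = (\<chi> i. if i = q then 1 else if i = j then - v $ q / v $ j else 0)"
  define b :: "'k ^ 3" where "b = (\<chi> i. if i = p then 1 else 0)"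
  define d :: "'k ^ 3" where "d = (\<chi> i. if i = q then 1 else 0)"
  have "frame v b d y z c"
    unfolding frame_def dot_def sum vec_eq_iff all y_def z_def c_def b_def d_def
    using j jpq jpq[symmetric] by (simp add: field_simps)
  then show thesis by (rule that)
qed

text \<open>The finitely many points in \<open>S\<close> are those where a form is going to be tested. The coordinate on the
  line is chosen so that none of them is its point at infinity, since only finite points are seen as
  zeros of the restricted polynomial. The parameter \<open>s\<close> moves the point at infinity along the line.\<close>
lemma frame_line:
  fixes c :: "'k::field_char_0 ^ 3"
  assumes "c \<noteq> 0" "finite S"
  obtains a b d y z where "frame a b d y z c" "pt b \<notin> S"
proof -
  obtain j p q where j: "c $ j \<noteq> 0" and jpq: "j \<noteq> p" "j \<noteq> q" "p \<noteq> q"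
    and U: "UNIV = {j, p, q}" using nonzero_coordinate[OF assms(1)] .
  have all: "(\<forall>i. P i) \<longleftrightarrow> P j \<and> P p \<and> P q" for P using U by (metis UNIV_I empty_iff insert_iff)
  have sum: "(\<Sum>i\<in>UNIV. f i) = f j + f p + f q" for f :: "3 \<Rightarrow> 'k"
    unfolding U using jpq by (simp add: add.assoc)
  define a where "a = (\<chi> i. if i = p then 1 else if i = j then - c $ p / c $ j else 0)"
  define b where "b s = (\<chi> i. if i = q then 1 else if i = p then s
      else if i = j then - (c $ q + s * c $ p) / c $ j else 0)" for s
  define d where "d = (\<chi> i. if i = j then 1 / c $ j else 0)"
  define y where "y s = (\<chi> i. if i = p then 1 else if i = q then - s else 0)" for s :: 'k
  define z :: "'k ^ 3" where "z = (\<chi> i. if i = q then 1 else 0)"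
  have frame: "frame a (b s) d (y s) z c" for s
    unfolding frame_def dot_def sum vec_eq_iff all y_def z_def a_def b_def d_def
    using j jpq jpq[symmetric] by (simp add: field_simps)
  have b0: "b s \<noteq> 0" for s by (auto simp: vec_eq_iff b_def intro!: exI[of _ q])
  have "inj (\<lambda>s. pt (b s))"
  proof (rule injI)
    fix s s' assume "pt (b s) = pt (b s')"
    then obtain k where "b s' = k *s b s" using pt_eq_iff[OF b0 b0] by blast
    then have "b s' $ q = k * b s $ q" "b s' $ p = k * b s $ p" by simp_all
    then show "s = s'" using jpq by (simp add: b_def)
  qed
  then have "infinite (range (\<lambda>s. pt (b s)))"
    using infinite_UNIV_char_0[where 'a = 'k] by (simp add: finite_image_iff)
  then obtain s where "pt (b s) \<notin> S" using assms(2) by (meson finite_subset image_subsetI)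
  then show thesis using frame by (intro that) auto
qed

lemma frame_nonzero:
  assumes "frame a b d y z c"
  shows "a + x *s b \<noteq> 0" "b \<noteq> 0"
proof -
  have "dot y (a + x *s b) = 1" "dot z b = 1"
    using assms by (simp_all add: frame_def dot_add_right dot_scale_right)
  then show "a + x *s b \<noteq> 0" "b \<noteq> 0" by force+
qed

lemma frame_dot_line:
  "frame a b d y z c \<Longrightarrow> dot c (a + x *s b) = 0"
  by (simp add: frame_def dot_add_right dot_scale_right)

lemma frame_line_point:
  fixes a :: "'k::field ^ 3"
  assumes fr: "frame a b d y z c" and "incident c P" "P \<noteq> pt b"
  obtains x where "P = pt (a + x *s b)"
proof -
  define v where "v = rep_proj_plane P"
  have v: "v \<noteq> 0" "pt v = P" "dot c v = 0"
    using assms(2) by (simp_all add: v_def rep_nonzero incident_rep)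
  have eq: "v = dot y v *s a + dot z v *s b"
    using fr v(3) unfolding frame_def by (metis add.right_neutral vector_smult_lzero)
  have y: "dot y v \<noteq> 0"
  proof
    assume "dot y v = 0"
    then have *: "v = dot z v *s b" using eq by (metis add.left_neutral vector_smult_lzero)
    then have "dot z v \<noteq> 0" using v(1) by (metis vector_smult_lzero)
    then have "pt b = pt v" using pt_eq_iff[OF frame_nonzero(2)[OF fr] v(1)] * by blast
    then show False using v(2) assms(3) by simp
  qed
  have "v = dot y v *s (a + (dot z v / dot y v) *s b)"
    by (subst eq) (use y in \<open>simp add: vector_add_ldistrib vector_smult_assoc\<close>)
  then have "pt (a + (dot z v / dot y v) *s b) = pt v"
    using pt_eq_iff[OF frame_nonzero(1)[OF fr] v(1)] y by blast
  then show thesis using v(2) by (intro that[of "dot z v / dot y v"]) simp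
qed

lemma pt_line_inj:
  assumes fr: "frame a b d y z c" and "pt (a + x *s b) = pt (a + x' *s b)"
  shows "x = x'"
proof -
  obtain s where s: "a + x' *s b = s *s (a + x *s b)"
    using assms(2) pt_eq_iff[OF frame_nonzero(1)[OF fr] frame_nonzero(1)[OF fr]] by blast
  have "dot y (a + x' *s b) = s * dot y (a + x *s b)" "dot z (a + x' *s b) = s * dot z (a + x *s b)"
    unfolding s dot_scale_right by simp_all
  then show ?thesis using fr by (simp add: frame_def dot_add_right dot_scale_right)
qed

text \<open>In the dual basis, \<open>c'\<close> has only the component \<open>(c' \<sqdot> d) c\<close>, so it is a multiple of \<open>c\<close>.\<close>
lemma frame_line_unique:
  fixes a :: "'k::field ^ 3"
  assumes fr: "frame a b d y z c" and c': "c' \<noteq> 0" "dot c' a = 0" "dot c' b = 0"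
  shows "{P. incident c' P} = {P. incident c P}"
proof -
  have eq: "dot c' w = dot c w * dot c' d" for w
  proof -
    have "dot c' w = dot c' (dot y w *s a + dot z w *s b + dot c w *s d)"
      using fr unfolding frame_def by metis
    then show ?thesis using c' by (simp add: dot_add_right dot_scale_right)
  qed
  have "dot c' d \<noteq> 0"
  proof
    assume "dot c' d = 0"
    then have 0: "dot c' w = 0" for w using eq[of w] by simp
    have "c' $ i = dot c' (axis i 1)" for i
      by (simp add: dot_def axis_def if_distrib[of "(*) _"] cong: if_cong)
    then show False using 0 c'(1) by (simp add: vec_eq_iff)
  qed
  then have "dot c' w = 0 \<longleftrightarrow> dot c w = 0" for w using eq[of w] by simp
  then show ?thesis by (simp add: incident_rep)
qed

section \<open>Powers of the ideal of a point\<close>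

interpretation poly3_ideal: module "(*) :: 'k::field poly3 \<Rightarrow> 'k poly3 \<Rightarrow> 'k poly3"
  by standard (simp_all add: algebra_simps)

lemma ideal_subspace: "poly3_ideal.subspace I \<Longrightarrow> poly3.subspace I"
  by (simp add: poly3_ideal.subspace_def poly3.subspace_def scale3_def)

lemma ideal_pow_ideal: "poly3_ideal.subspace (ideal_pow I m)"
  by (cases m) (simp_all add: ideal_gen_def poly3_ideal.subspace_UNIV)

lemma ideal_pow_mult: "f \<in> I \<Longrightarrow> g \<in> ideal_pow I m \<Longrightarrow> f * g \<in> ideal_pow I (Suc m)"
  by (auto simp: ideal_gen_def intro!: poly3_ideal.span_base)

lemma ideal_pow_power_mult: "f \<in> I \<Longrightarrow> g \<in> ideal_pow I m \<Longrightarrow> f ^ n * g \<in> ideal_pow I (n + m)"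
proof (induction n)
  case (Suc n)
  then show ?case using ideal_pow_mult[of f I "f ^ n * g" "n + m"]
    by (simp only: power_Suc mult.assoc add_Suc)
qed simp

lemma ideal_pow_Suc_le: "ideal_pow I (Suc m) \<subseteq> ideal_pow I m"
proof -
  have "{f * g |f g. f \<in> I \<and> g \<in> ideal_pow I m} \<subseteq> ideal_pow I m"
    using ideal_pow_ideal[of I m] by (auto intro: poly3_ideal.subspace_scale)
  then show ?thesis
    using ideal_pow_ideal[of I m] by (simp add: ideal_gen_def poly3_ideal.span_minimal)
qed

lemma ideal_pow_antimono: "m \<le> n \<Longrightarrow> ideal_pow I n \<subseteq> ideal_pow I m"
  by (rule lift_Suc_antimono_le[of "ideal_pow I", OF ideal_pow_Suc_le])

lemma lin3_point_ideal:
  assumes "incident c P"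
  shows "lin3 c \<in> point_ideal P"
proof -
  have "vanishes_at (lin3 c) P"
    using assms by (simp add: vanishes_at.rep_eq eval3_lin3 dot_scale_right incident_rep)
  then show ?thesis
    unfolding point_ideal_def ideal_gen_def using lin3_homogeneous by (intro poly3_ideal.span_base) auto
qed

lemma restr_point_ideal:
  assumes "f \<in> point_ideal (pt (a + x *s b))" "a + x *s b \<noteq> 0"
  shows "[:- x, 1:] dvd restr a b f"
proof -
  let ?I = "{f. [:- x, 1:] dvd restr a b f}"
  have "poly3_ideal.subspace ?I"
    by (auto simp: poly3_ideal.subspace_def restr_add restr_mult)
  moreover have "{f. (\<exists>d. f \<in> homogeneous_part d) \<and> vanishes_at f (pt (a + x *s b))} \<subseteq> ?I"
  proof safe
    fix f d assume "vanishes_at f (pt (a + x *s b))"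
    then have "eval3 f (1 *s (a + x *s b)) = 0"
      unfolding vanishes_at_pt[OF assms(2)] by (metis one_neq_zero)
    then show "[:- x, 1:] dvd restr a b f"
      by (simp add: poly_eq_0_iff_dvd[symmetric] poly_restr)
  qed
  ultimately show ?thesis
    using assms(1) poly3_ideal.span_minimal unfolding point_ideal_def ideal_gen_def by blast
qed

lemma restr_ideal_pow:
  assumes "f \<in> ideal_pow (point_ideal (pt (a + x *s b))) m" "a + x *s b \<noteq> 0"
  shows "[:- x, 1:] ^ m dvd restr a b f"
  using assms(1)
proof (induction m arbitrary: f)
  case (Suc m)
  let ?I = "{f. [:- x, 1:] ^ Suc m dvd restr a b f}"
  have "poly3_ideal.subspace ?I"
    by (auto simp: poly3_ideal.subspace_def restr_add restr_mult simp del: power_Suc)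
  moreover have "{f * g |f g. f \<in> point_ideal (pt (a + x *s b)) \<and>
      g \<in> ideal_pow (point_ideal (pt (a + x *s b))) m} \<subseteq> ?I"
    using Suc.IH restr_point_ideal[OF _ assms(2)] unfolding power_Suc by (auto simp only: restr_mult intro!: mult_dvd_mono)
  ultimately show ?case
    using Suc.prems poly3_ideal.span_minimal unfolding ideal_pow.simps ideal_gen_def by blast
qed simp

lemma one_neq_zero_vec: "(1 :: 'k::field ^ 3) \<noteq> 0"
  by (auto simp: vec_eq_iff)

lemma finite_span_homogeneous:
  obtains F where "finite F" "homogeneous_part t \<subseteq> poly3.span (F :: 'k::field poly3 set)"
proof -
  obtain b d y z c where "frame (1 :: 'k ^ 3) b d y z c"
    using frame_point[of "1 :: 'k ^ 3"] by (metis one_neq_zero_vec)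
  from homogeneous_span_frame[OF this] show thesis
    by (rule that[rotated]) (simp add: frame_monomials_def finite_le_pairs)
qed

text \<open>The degree \<open>m (m + 1) / 2\<close> of an \<open>m\<close>-fold point.\<close>
definition point_degree :: "nat \<Rightarrow> nat" where
  "point_degree m = (\<Sum>k<m. Suc k)"

text \<open>Taylor expansion at \<open>P\<close>: in a frame whose first vector represents \<open>P\<close>, the forms \<open>z\<close> and \<open>c\<close> vanish at
  \<open>P\<close>. Modulo the \<open>m\<close>-th power of the ideal of \<open>P\<close> only the monomials of order less than \<open>m\<close> in \<open>z\<close> and \<open>c\<close>
  remain.\<close>
lemma point_degree_codim:
  "poly3.spans_mod (homogeneous_part t)
     (homogeneous_part t \<inter> ideal_pow (point_ideal P) m) (point_degree m)"
proof -
  obtain b d y z c where fr: "frame (rep_proj_plane P) b d y z c"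
    using frame_point[OF rep_nonzero] .
  have inc: "incident z P" "incident c P" using fr by (simp_all add: frame_def incident_rep)
  let ?m = "\<lambda>(j, k). lin3 y ^ (t - j - k) * lin3 z ^ j * lin3 c ^ k"
  let ?B = "?m ` {(j, k). j + k \<le> t \<and> j + k < m}" and ?C = "?m ` {(j, k). j + k \<le> t \<and> m \<le> j + k}"
  have BC: "frame_monomials t y z c = ?B \<union> ?C"
    unfolding frame_monomials_def image_Un[symmetric] by (intro arg_cong[where f = "image ?m"]) auto
  have fin: "finite {(j, k). j + k \<le> t \<and> j + k < m}"
    by (rule finite_subset[OF _ finite_le_pairs[of t]]) auto
  have "card ?B \<le> card {(j, k). j + k \<le> t \<and> j + k < m}" using fin by (rule card_image_le)
  also have "\<dots> \<le> card ((\<lambda>(s, k). (s - k, k)) ` (SIGMA s:{..<m}. {..s}))"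
  proof (rule card_mono)
    show "{(j, k). j + k \<le> t \<and> j + k < m} \<subseteq> (\<lambda>(s, k). (s - k, k)) ` (SIGMA s:{..<m}. {..s})"
    proof clarify
      fix j k assume "j + k < m"
      then show "(j, k) \<in> (\<lambda>(s, k). (s - k, k)) ` (SIGMA s:{..<m}. {..s})"
        by (intro image_eqI[of _ _ "(j + k, k)"]) auto
    qed
  qed simp
  also have "\<dots> \<le> card (SIGMA s:{..<m}. {..s})" by (rule card_image_le) auto
  also have "\<dots> = point_degree m" by (simp add: point_degree_def)
  finally have card: "card ?B \<le> point_degree m" .
  have "lin3 y ^ (t - j - k) * lin3 z ^ j * lin3 c ^ k \<in> ideal_pow (point_ideal P) m"
    if "m \<le> j + k" for j k
  proof -
    have "lin3 z ^ j * (lin3 c ^ k * lin3 y ^ (t - j - k)) \<in> ideal_pow (point_ideal P) (j + (k + 0))"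
      using inc lin3_point_ideal by (intro ideal_pow_power_mult) auto
    then have "lin3 z ^ j * (lin3 c ^ k * lin3 y ^ (t - j - k)) \<in> ideal_pow (point_ideal P) m"
      unfolding add_0_right by (rule subsetD[OF ideal_pow_antimono[OF that]])
    then show ?thesis by (simp only: mult_ac)
  qed
  then have "?C \<subseteq> ideal_pow (point_ideal P) m" by (simp add: image_subset_iff split_beta)
  moreover have hom: "?B \<subseteq> homogeneous_part t" "?C \<subseteq> homogeneous_part t"
    using frame_monomials_homogeneous[of t y z c] unfolding BC by (simp_all only: Un_subset_iff)
  ultimately have C: "?C \<subseteq> homogeneous_part t \<inter> ideal_pow (point_ideal P) m"
    by (simp only: Int_subset_iff)
  show ?thesis
  proof (rule poly3.spans_modI[of ?B _ _ _ ?C])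
    show "finite ?B" using fin by simp
    show "?B \<subseteq> homogeneous_part t" using hom(1) .
    show "poly3.subspace (homogeneous_part t \<inter> ideal_pow (point_ideal P) m)"
      using subspace_homogeneous ideal_subspace[OF ideal_pow_ideal] by (rule poly3.subspace_inter)
    show "homogeneous_part t \<subseteq> poly3.span (?B \<union> ?C)"
      using homogeneous_span_frame[OF fr, of t] unfolding BC .
    show "card ?B \<le> point_degree m" using card .
    show "?C \<subseteq> homogeneous_part t \<inter> ideal_pow (point_ideal P) m" using C .
  qed
qed


section \<open>Residuation along a line\<close>

abbreviation zeros :: "'k::field ^ 3 \<Rightarrow> 'k proj_plane set" where
  "zeros c \<equiv> {P. incident c P}"

text \<open>The scheme \<open>Z : L\<close> defined by the ideal quotient with respect to the equation of the line \<open>L\<close>.\<close>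
definition residual :: "'a set \<Rightarrow> 'a multiset \<Rightarrow> 'a multiset" where
  "residual L Z = Z - mset_set (set_mset Z \<inter> L)"

text \<open>The degree of the scheme-theoretic intersection of \<open>Z\<close> and \<open>L\<close>.\<close>
definition on_line :: "'a set \<Rightarrow> 'a multiset \<Rightarrow> nat" where
  "on_line L Z = (\<Sum>P\<in>set_mset Z \<inter> L. count Z P)"

lemma count_residual: "count (residual L Z) P = count Z P - (if P \<in> L then 1 else 0)"
  by (auto simp: residual_def count_mset_set' not_in_iff)

definition fat_degree :: "'a multiset \<Rightarrow> nat" where
  "fat_degree Z = (\<Sum>P\<in>set_mset Z. point_degree (count Z P))"

text \<open>An \<open>m\<close>-fold point has degree \<open>m\<close> more than an \<open>(m - 1)\<close>-fold point.\<close>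
lemma fat_degree_residual: "fat_degree Z = on_line L Z + fat_degree (residual L Z)"
proof -
  have deg: "point_degree m = m + point_degree (m - 1)" for m
    by (cases m) (simp_all add: point_degree_def)
  have res: "fat_degree (residual L Z) = (\<Sum>P\<in>set_mset Z. point_degree (count (residual L Z) P))"
    unfolding fat_degree_def
    by (rule sum.mono_neutral_left)
      (auto simp: residual_def point_degree_def not_in_iff dest: in_diffD)
  have on: "on_line L Z = (\<Sum>P\<in>set_mset Z. if P \<in> L then count Z P else 0)"
    by (simp add: on_line_def sum.inter_restrict)
  have "point_degree (count Z P)
      = (if P \<in> L then count Z P else 0) + point_degree (count (residual L Z) P)" for P
    using deg[of "count Z P"] by (simp add: count_residual)
  then show ?thesis
    unfolding res on sum.distrib[symmetric] fat_degree_def[of Z] by simp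
qed

subsection \<open>Upper bounds\<close>

lemma mem_fat_ideal: "f \<in> fat_ideal Z \<longleftrightarrow> (\<forall>P. f \<in> ideal_pow (point_ideal P) (count Z P))"
proof -
  have "f \<in> ideal_pow (point_ideal P) (count Z P)" if "P \<notin># Z" for P
    using that by (simp add: not_in_iff)
  then show ?thesis unfolding fat_ideal_def by blast
qed

lemma subspace_fat_ideal: "poly3.subspace (fat_ideal Z)"
  unfolding fat_ideal_def
proof (rule poly3.subspace_Inter, clarify)
  show "poly3.subspace (ideal_pow (point_ideal P) (count Z P))" for P
    by (rule ideal_subspace[OF ideal_pow_ideal])
qed

lemma subspace_fat_part: "poly3.subspace (fat_ideal Z \<inter> homogeneous_part t)"
  by (intro poly3.subspace_inter subspace_fat_ideal subspace_homogeneous)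

lemma spans_fat_degree:
  fixes Z :: "'k::field fat_points"
  shows "poly3.spans_mod (homogeneous_part t) (fat_ideal Z \<inter> homogeneous_part t) (fat_degree Z)"
proof -
  obtain F where F: "finite F" "homogeneous_part t \<subseteq> poly3.span (F :: 'k poly3 set)"
    using finite_span_homogeneous .
  have "poly3.spans_mod (homogeneous_part t)
      (homogeneous_part t \<inter> (\<Inter>P\<in>set_mset Z. ideal_pow (point_ideal P) (count Z P)))
      (\<Sum>P\<in>set_mset Z. point_degree (count Z P))"
    using ideal_subspace[OF ideal_pow_ideal] point_degree_codim
    by (intro poly3.spans_mod_Inter[OF _ subspace_homogeneous F]) auto
  then show ?thesis by (simp add: fat_ideal_def fat_degree_def Int_commute)
qed

lemma lin3_mult_fat_ideal:
  assumes "f \<in> fat_ideal (residual (zeros c) Z)"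
  shows "lin3 c * f \<in> fat_ideal Z"
  unfolding mem_fat_ideal
proof
  fix P
  have f: "f \<in> ideal_pow (point_ideal P) (count Z P - (if incident c P then 1 else 0))"
    using assms unfolding mem_fat_ideal count_residual by simp
  show "lin3 c * f \<in> ideal_pow (point_ideal P) (count Z P)"
  proof (cases "incident c P \<and> count Z P \<noteq> 0")
    case True
    then show ?thesis
      using ideal_pow_mult[OF lin3_point_ideal, of c P f "count Z P - 1"] f by simp
  next
    case False
    then have "count Z P - (if incident c P then 1 else 0) = count Z P" by (auto simp: not_in_iff)
    then have "f \<in> ideal_pow (point_ideal P) (count Z P)" using f by simp
    then show ?thesis by (rule poly3_ideal.subspace_scale[OF ideal_pow_ideal])
  qed
qed

text \<open>The quotient is the space of forms of degree \<open>t + 1\<close> in the two coordinates of the line.\<close>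
lemma spans_mod_line:
  fixes c :: "'k::field_char_0 ^ 3"
  assumes "c \<noteq> 0"
  shows "poly3.spans_mod (homogeneous_part (Suc t)) ((\<lambda>f. lin3 c * f) ` homogeneous_part t) (Suc (Suc t))"
proof -
  obtain a b d y z where fr: "frame a b d y z c" and "pt b \<notin> {}"
    using frame_line[OF assms finite.emptyI] .
  let ?m = "\<lambda>(j, k). lin3 y ^ (Suc t - j - k) * lin3 z ^ j * lin3 c ^ k"
  let ?B = "?m ` {(j, k). j + k \<le> Suc t \<and> k = 0}" and ?C = "?m ` {(j, k). j + k \<le> Suc t \<and> k \<noteq> 0}"
  have BC: "frame_monomials (Suc t) y z c = ?B \<union> ?C"
    unfolding frame_monomials_def image_Un[symmetric] by (intro arg_cong[where f = "image ?m"]) auto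
  have eq: "{(j, k). j + k \<le> Suc t \<and> k = 0} = (\<lambda>j. (j, 0)) ` {..Suc t}" by auto
  have "card ?B \<le> card {..Suc t}" unfolding eq image_image by (rule card_image_le) simp
  then have card: "card ?B \<le> Suc (Suc t)" by simp
  have fin: "finite ?B" unfolding eq by simp
  have hom: "?B \<subseteq> homogeneous_part (Suc t)" "?C \<subseteq> homogeneous_part (Suc t)"
    using frame_monomials_homogeneous[of "Suc t" y z c] unfolding BC by (simp_all only: Un_subset_iff)
  have C: "?C \<subseteq> (\<lambda>f. lin3 c * f) ` homogeneous_part t"
  proof clarify
    fix j k :: nat assume jk: "j + k \<le> Suc t" "k > 0"
    then obtain k' where k: "k = Suc k'" by (cases k) auto
    have "lin3 y ^ (t - j - k') * lin3 z ^ j * lin3 c ^ k' \<in> frame_monomials t y z c"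
      using jk k by (auto simp: frame_monomials_def image_iff)
    then have "lin3 y ^ (t - j - k') * lin3 z ^ j * lin3 c ^ k' \<in> homogeneous_part t"
      using frame_monomials_homogeneous by blast
    moreover have "Suc t - j - k = t - j - k'" using jk k by simp
    then have "lin3 y ^ (Suc t - j - k) * lin3 z ^ j * lin3 c ^ k
        = lin3 c * (lin3 y ^ (t - j - k') * lin3 z ^ j * lin3 c ^ k')"
      unfolding k by (simp only: power_Suc mult_ac)
    ultimately show "lin3 y ^ (Suc t - j - k) * lin3 z ^ j * lin3 c ^ k
        \<in> (\<lambda>f. lin3 c * f) ` homogeneous_part t" by (rule rev_image_eqI)
  qed
  show ?thesis
  proof (rule poly3.spans_modI[OF fin card hom(1) _ _ C])
    show "poly3.subspace ((\<lambda>f. lin3 c * f) ` homogeneous_part t)"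
      unfolding poly3.subspace_def
    proof (intro conjI allI ballI; (elim imageE)?)
      show "0 \<in> (\<lambda>f. lin3 c * f) ` homogeneous_part t"
        using poly3.subspace_0[OF subspace_homogeneous] by (intro image_eqI[of _ _ 0]) simp_all
    next
      fix f g h k assume "h = lin3 c * f" "k = lin3 c * g" and
        fg: "f \<in> homogeneous_part t" "g \<in> homogeneous_part t"
      then have "h + k = lin3 c * (f + g)" by (simp only: distrib_left)
      then show "h + k \<in> (\<lambda>f. lin3 c * f) ` homogeneous_part t"
        using poly3.subspace_add[OF subspace_homogeneous fg] by (rule image_eqI)
    next
      fix s f h assume "h = lin3 c * f" and f: "f \<in> homogeneous_part t"
      then have "scale3 s h = lin3 c * scale3 s f" by (simp only: scale3_mult_right)
      then show "scale3 s h \<in> (\<lambda>f. lin3 c * f) ` homogeneous_part t"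
        using poly3.subspace_scale[OF subspace_homogeneous f] by (rule image_eqI)
    qed
    show "homogeneous_part (Suc t) \<subseteq> poly3.span (?B \<union> ?C)"
      using homogeneous_span_frame[OF fr, of "Suc t"] unfolding BC .
  qed
qed

text \<open>For \<open>Z' = Z : \<ell>\<close> there is an exact sequence
  \<open>0 \<rightarrow> (R / I\<^bsub>Z'\<^esub>)(-1) \<rightarrow> R / I\<^sub>Z \<rightarrow> R / (I\<^sub>Z + (\<ell>)) \<rightarrow> 0\<close>, whose last term is a quotient of the coordinate ring of
  the line.\<close>
lemma spans_mod_residual:
  fixes c :: "'k::field_char_0 ^ 3"
  assumes "c \<noteq> 0"
    and sp: "poly3.spans_mod (homogeneous_part t)
      (fat_ideal (residual (zeros c) Z) \<inter> homogeneous_part t) n"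
  shows "poly3.spans_mod (homogeneous_part (Suc t))
      (fat_ideal Z \<inter> homogeneous_part (Suc t)) (Suc (Suc t) + n)"
proof (rule poly3.spans_mod_trans[OF spans_mod_line[OF assms(1)]])
  have hom: "lin3 c * f \<in> homogeneous_part (Suc t)" if "f \<in> homogeneous_part t" for f
    using homogeneous_mult[OF lin3_homogeneous that, of c] by simp
  then show "(\<lambda>f. lin3 c * f) ` homogeneous_part t \<subseteq> homogeneous_part (Suc t)" by blast
  obtain B where B: "finite B" "card B \<le> n" "B \<subseteq> homogeneous_part t"
    and gen: "\<And>f. f \<in> homogeneous_part t \<Longrightarrow> \<exists>b\<in>poly3.span B.
      f - b \<in> fat_ideal (residual (zeros c) Z) \<inter> homogeneous_part t"
    using sp unfolding poly3.spans_mod_def by blast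
  let ?B = "(\<lambda>f. lin3 c * f) ` B"
  have "poly3.subspace {f. lin3 c * f \<in> poly3.span ?B}"
    by (auto simp: poly3.subspace_def distrib_left scale3_mult_right poly3.span_zero
        poly3.span_add poly3.span_scale)
  moreover have "B \<subseteq> {f. lin3 c * f \<in> poly3.span ?B}" by (auto intro: poly3.span_base)
  ultimately have span: "poly3.span B \<subseteq> {f. lin3 c * f \<in> poly3.span ?B}"
    by (rule poly3.span_minimal[rotated])
  show "poly3.spans_mod ((\<lambda>f. lin3 c * f) ` homogeneous_part t)
      (fat_ideal Z \<inter> homogeneous_part (Suc t)) n"
    unfolding poly3.spans_mod_def
  proof (intro exI[of _ ?B] conjI ballI)
    show "finite ?B" "?B \<subseteq> (\<lambda>f. lin3 c * f) ` homogeneous_part t" using B by auto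
    show "card ?B \<le> n" using card_image_le[OF B(1)] B(2) by (rule order_trans)
  next
    fix g assume "g \<in> (\<lambda>f. lin3 c * f) ` homogeneous_part t"
    then obtain f where f: "g = lin3 c * f" "f \<in> homogeneous_part t" by blast
    then obtain e where e: "e \<in> poly3.span B"
      "f - e \<in> fat_ideal (residual (zeros c) Z)" "f - e \<in> homogeneous_part t"
      using gen by blast
    have "g - lin3 c * e = lin3 c * (f - e)" by (simp add: f right_diff_distrib)
    then have "g - lin3 c * e \<in> fat_ideal Z \<inter> homogeneous_part (Suc t)"
      using lin3_mult_fat_ideal[OF e(2)] hom[OF e(3)] by simp
    then show "\<exists>b\<in>poly3.span ?B. g - b \<in> fat_ideal Z \<inter> homogeneous_part (Suc t)"
      using span e(1) by (intro bexI[of _ "lin3 c * e"]) auto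
  qed
qed

lemma spans_mod_degree_0:
  fixes W :: "'k::field poly3 set"
  assumes "poly3.subspace W"
  shows "poly3.spans_mod (homogeneous_part 0) W 1"
proof -
  obtain b d y z c where fr: "frame (1 :: 'k ^ 3) b d y z c"
    using frame_point[OF one_neq_zero_vec] .
  have eq: "frame_monomials 0 y z c = {1}" by (auto simp: frame_monomials_def image_iff)
  show ?thesis
  proof (rule poly3.spans_modI)
    show "homogeneous_part 0 \<subseteq> poly3.span ({1 :: 'k poly3} \<union> {})"
      using homogeneous_span_frame[OF fr, of 0] unfolding eq by simp
    show "{1 :: 'k poly3} \<subseteq> homogeneous_part 0" using homogeneous_one by simp
  qed (use assms in simp_all)
qed

subsection \<open>Lower bounds\<close>

text \<open>For lower bounds the ideal of \<open>Z\<close> is replaced by the larger space of forms whose restriction to each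
  line of a list has a zero of the required order at every point of that line. Unlike membership in a
  power of an ideal, this condition passes directly from a multiple of the equation of one line to
  the cofactor, tested on the other lines and with respect to the residual scheme.\<close>
definition vanishing_on_lines :: "('k::field ^ 3) list \<Rightarrow> 'k fat_points \<Rightarrow> 'k poly3 set" where
  "vanishing_on_lines cs Z = {f. \<forall>c\<in>set cs. \<forall>a b d y z x. frame a b d y z c \<longrightarrow>
     [:- x, 1:] ^ count Z (pt (a + x *s b)) dvd restr a b f}"

lemma vanishing_on_linesD:
  assumes "f \<in> vanishing_on_lines cs Z" "c \<in> set cs" "frame a b d y z c"
  shows "[:- x, 1:] ^ count Z (pt (a + x *s b)) dvd restr a b f"
  using assms unfolding vanishing_on_lines_def by blast

lemma fat_ideal_vanishing: "fat_ideal Z \<subseteq> vanishing_on_lines cs Z"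
proof
  fix f :: "'a poly3" assume f: "f \<in> fat_ideal Z"
  have *: "[:- x, 1:] ^ count Z (pt (a + x *s b)) dvd restr a b f" if fr: "frame a b d y z c"
    for a b d y z c x
    using f by (intro restr_ideal_pow frame_nonzero(1)[OF fr]) (simp add: mem_fat_ideal)
  show "f \<in> vanishing_on_lines cs Z"
    unfolding vanishing_on_lines_def by (intro CollectI ballI allI impI) (rule *)
qed

lemma linear_factor_dvd:
  fixes p g :: "'k::field poly"
  assumes "p \<noteq> 0" "degree p \<le> 1" "[:- x, 1:] ^ m dvd p * g"
  shows "[:- x, 1:] ^ (m - (if poly p x = 0 then 1 else 0)) dvd g"
proof (cases "g = 0")
  case False
  then have "m \<le> order x p + order x g"
    using assms(1,3) by (simp add: order_divides order_mult)
  moreover have "order x p \<le> (if poly p x = 0 then 1 else 0)"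
    using order_degree[OF assms(1), of x] assms(2) order_0I[of p x] by auto
  ultimately show ?thesis by (auto simp: order_divides)
qed simp

text \<open>Restricted to another line, the equation \<open>c\<close> has at most a simple zero, and it has one exactly where
  the two lines meet; this is the multiplicity that the residual scheme loses.\<close>
lemma vanishing_residual:
  fixes c :: "'k::field ^ 3"
  assumes "c \<noteq> 0" "zeros c \<notin> zeros ` set cs" "lin3 c * g \<in> vanishing_on_lines (c # cs) Z"
  shows "g \<in> vanishing_on_lines cs (residual (zeros c) Z)"
  unfolding vanishing_on_lines_def
proof safe
  fix c' a b d y z x assume c': "c' \<in> set cs" and fr: "frame a b d y z c'"
  let ?p = "[:dot c a, dot c b:]"
  have "\<not> (dot c a = 0 \<and> dot c b = 0)"
    using frame_line_unique[OF fr assms(1)] assms(2) c' by blast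
  then have "?p \<noteq> 0" by simp
  moreover have "[:- x, 1:] ^ count Z (pt (a + x *s b)) dvd ?p * restr a b g"
    using vanishing_on_linesD[OF assms(3) _ fr, of x] c'
    unfolding restr_lin3[symmetric] restr_mult[symmetric] by simp
  ultimately have "[:- x, 1:] ^ (count Z (pt (a + x *s b)) - (if poly ?p x = 0 then 1 else 0))
      dvd restr a b g"
    by (intro linear_factor_dvd) auto
  moreover have "poly ?p x = 0 \<longleftrightarrow> incident c (pt (a + x *s b))"
    using frame_nonzero(1)[OF fr, of x] by (simp add: incident_pt dot_add_right dot_scale_right)
  ultimately show "[:- x, 1:] ^ count (residual (zeros c) Z) (pt (a + x *s b)) dvd restr a b g"
    by (simp add: count_residual)
qed

text \<open>The restricted polynomial has as many zeros on the line as the degree of \<open>Z\<close> there, counted with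
  multiplicity.\<close>
lemma restr_degree_vanishing:
  fixes c :: "'k::field ^ 3"
  assumes fr: "frame a b d y z c" and b: "pt b \<notin># Z"
    and f: "f \<in> vanishing_on_lines (c # cs) Z" and deg: "degree (restr a b f) < on_line (zeros c) Z"
  shows "restr a b f = 0"
proof (rule ccontr)
  let ?g = "restr a b f"
  assume g: "?g \<noteq> 0"
  let ?S = "{x. pt (a + x *s b) \<in># Z}"
  have inj: "inj (\<lambda>x. pt (a + x *s b))" using pt_line_inj[OF fr] by (auto intro: injI)
  have img: "set_mset Z \<inter> zeros c = (\<lambda>x. pt (a + x *s b)) ` ?S"
  proof safe
    fix P assume P: "P \<in># Z" "incident c P"
    then obtain x where "P = pt (a + x *s b)" using frame_line_point[OF fr P(2)] b by metis
    then show "P \<in> (\<lambda>x. pt (a + x *s b)) ` ?S" using P by blast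
  qed (use fr frame_nonzero(1)[OF fr] in \<open>auto simp: incident_pt frame_dot_line\<close>)
  have dvd: "count Z (pt (a + x *s b)) \<le> order x ?g" for x
    using vanishing_on_linesD[OF f _ fr, of x] g by (simp add: order_divides)
  have root: "?S \<subseteq> {x. poly ?g x = 0}"
  proof safe
    fix x assume "pt (a + x *s b) \<in># Z"
    then have "order x ?g \<noteq> 0" using dvd[of x] by (metis count_greater_zero_iff le_zero_eq less_numeral_extra(3))
    then show "poly ?g x = 0" by (simp add: order_root)
  qed
  have "on_line (zeros c) Z = (\<Sum>x\<in>?S. count Z (pt (a + x *s b)))"
    unfolding on_line_def img using inj by (subst sum.reindex) (auto intro: inj_on_subset)
  also have "\<dots> \<le> (\<Sum>x\<in>?S. order x ?g)" by (intro sum_mono dvd)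
  also have "\<dots> \<le> (\<Sum>x | poly ?g x = 0. order x ?g)"
    using g root by (intro sum_mono2) (auto simp: poly_roots_finite)
  also have "\<dots> \<le> degree ?g" by (rule sum_order_le_degree[OF g])
  finally show False using deg by simp
qed

text \<open>The Hilbert function that belongs to a decreasing reduction vector. The recursion follows the
  passage from a scheme in degree \<open>t\<close> to its residual scheme in degree \<open>t - 1\<close>.\<close>
primrec line_sum :: "nat list \<Rightarrow> nat \<Rightarrow> nat" where
  "line_sum [] t = 0"
| "line_sum (d # ds) t = min (Suc t) d + (case t of 0 \<Rightarrow> 0 | Suc s \<Rightarrow> line_sum ds s)"

primrec reduction :: "('k::field ^ 3) list \<Rightarrow> 'k fat_points \<Rightarrow> nat list" where
  "reduction [] Z = []"
| "reduction (c # cs) Z = on_line (zeros c) Z # reduction cs (residual (zeros c) Z)"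

definition distinct_lines :: "('k::field ^ 3) list \<Rightarrow> bool" where
  "distinct_lines cs \<longleftrightarrow> 0 \<notin> set cs \<and> distinct (map zeros cs)"

text \<open>The first \<open>m\<close> elements are chosen to restrict to the powers \<open>1, X, \<dots>, X\<^bsup>m-1\<^esup>\<close> on the line \<open>c\<close>, the others
  are multiples of \<open>c\<close>. A relation is first restricted to that line, which kills the first \<open>m\<close>
  coefficients, and then divided by \<open>c\<close>. In degree \<open>0\<close> there are no multiples of \<open>c\<close>.\<close>
lemma indep_mod_line:
  fixes c :: "'k::field_char_0 ^ 3"
  assumes c: "c \<noteq> 0" "zeros c \<notin> zeros ` set cs"
    and n: "case t of 0 \<Rightarrow> n = 0
      | Suc s \<Rightarrow> poly3.indep_mod (homogeneous_part s) (vanishing_on_lines cs (residual (zeros c) Z)) n"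
  shows "poly3.indep_mod (homogeneous_part t) (vanishing_on_lines (c # cs) Z)
    (min (Suc t) (on_line (zeros c) Z) + n)"
proof -
  define m where "m = min (Suc t) (on_line (zeros c) Z)"
  obtain a b d y z where fr: "frame a b d y z c" and b: "pt b \<notin># Z"
    using frame_line[OF c(1) finite_set_mset, of Z] .
  obtain u' where u': "\<And>i. i < n \<Longrightarrow> lin3 c * u' i \<in> homogeneous_part t"
    and ind: "\<And>w. (\<Sum>i<n. scale3 (w i) (u' i)) \<in> vanishing_on_lines cs (residual (zeros c) Z)
      \<Longrightarrow> \<forall>i<n. w i = 0"
  proof (cases t)
    case 0
    then show thesis using n by (intro that) auto
  next
    case (Suc s)
    then obtain u where u: "\<forall>i<n. u i \<in> homogeneous_part s"
      "\<forall>w. (\<Sum>i<n. scale3 (w i) (u i)) \<in> vanishing_on_lines cs (residual (zeros c) Z) \<longrightarrow> (\<forall>i<n. w i = 0)"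
      using n unfolding poly3.indep_mod_def by auto
    show thesis
    proof (rule that[of u])
      show "lin3 c * u i \<in> homogeneous_part t" if "i < n" for i
        using homogeneous_mult[OF lin3_homogeneous, of "u i" s c] u(1) that Suc by simp
    qed (use u(2) in blast)
  qed
  define u where "u i = (if i < m then lin3 y ^ (t - i) * lin3 z ^ i else lin3 c * u' (i - m))" for i
  have "poly3.indep_mod (homogeneous_part t) (vanishing_on_lines (c # cs) Z) (m + n)"
    unfolding poly3.indep_mod_def
  proof (intro exI[of _ u] conjI allI impI)
    fix i assume i: "i < m + n"
    show "u i \<in> homogeneous_part t"
    proof (cases "i < m")
      case True
      then have "i \<le> t" by (simp add: m_def)
      then show ?thesis using True
          homogeneous_mult[OF lin3_power_homogeneous lin3_power_homogeneous, of y "t - i" z i]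
        by (simp add: u_def)
    qed (use u' i in \<open>simp add: u_def\<close>)
  next
    fix w i assume w: "(\<Sum>i<m + n. scale3 (w i) (u i)) \<in> vanishing_on_lines (c # cs) Z"
      and i: "i < m + n"
    let ?f = "\<Sum>i<m. scale3 (w i) (lin3 y ^ (t - i) * lin3 z ^ i)"
    let ?h = "\<Sum>i<n. scale3 (w (m + i)) (u' i)"
    have split: "(\<Sum>i<m + n. scale3 (w i) (u i)) = ?f + lin3 c * ?h"
    proof -
      have "(\<Sum>i<m + n. scale3 (w i) (u i))
          = (\<Sum>i<m. scale3 (w i) (u i)) + (\<Sum>i<n. scale3 (w (m + i)) (u (m + i)))"
        by (induction n) (simp_all add: add.assoc)
      then show ?thesis by (simp add: u_def sum_distrib_left scale3_mult_right)
    qed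
    have "restr a b ?f = (\<Sum>i<m. monom (w i) i)"
      using fr by (simp add: frame_def restr_sum restr_scale3 restr_mult restr_power restr_lin3
          monom_altdef one_pCons[symmetric])
    then have restr: "restr a b (?f + lin3 c * ?h) = (\<Sum>i<m. monom (w i) i)"
      using fr by (simp add: frame_def restr_add restr_mult restr_lin3)
    have 0: "(\<Sum>i<m. monom (w i) i) = 0"
    proof (cases "m = 0")
      case False
      have "degree (\<Sum>i<m. monom (w i) i) \<le> m - 1"
        by (intro degree_sum_le) (auto intro: order_trans[OF degree_monom_le])
      moreover have "m \<le> on_line (zeros c) Z" by (simp add: m_def)
      ultimately have "degree (restr a b (?f + lin3 c * ?h)) < on_line (zeros c) Z"
        using False unfolding restr by linarith
      then have "restr a b (?f + lin3 c * ?h) = 0"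
        by (rule restr_degree_vanishing[OF fr b w[unfolded split]])
      then show ?thesis using restr by (rule trans[OF sym, rotated])
    qed simp
    have w1: "w i = 0" if "i < m" for i
    proof -
      have "coeff (\<Sum>i<m. monom (w i) i) i = w i"
        using that by (simp add: coeff_sum if_distrib cong: if_cong)
      then show ?thesis using 0 by simp
    qed
    then have "?f = 0" by (intro sum.neutral) simp
    then have "lin3 c * ?h \<in> vanishing_on_lines (c # cs) Z" using w unfolding split by simp
    then have "?h \<in> vanishing_on_lines cs (residual (zeros c) Z)"
      by (rule vanishing_residual[OF c])
    then have w2: "\<forall>i<n. w (m + i) = 0" using ind[of "\<lambda>i. w (m + i)"] by blast
    show "w i = 0"
    proof (cases "i < m")
      case False
      then show ?thesis using w2[rule_format, of "i - m"] i by simp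
    qed (rule w1)
  qed
  then show ?thesis by (simp add: m_def)
qed

lemma indep_mod_reduction:
  fixes cs :: "('k::field_char_0 ^ 3) list"
  assumes "distinct_lines cs"
  shows "poly3.indep_mod (homogeneous_part t) (vanishing_on_lines cs Z) (line_sum (reduction cs Z) t)"
  using assms
proof (induction cs arbitrary: t Z)
  case Nil
  then show ?case by (simp add: poly3.indep_mod_def)
next
  case (Cons c cs)
  have "c \<noteq> 0" "zeros c \<notin> zeros ` set cs" and cs: "distinct_lines cs"
    using Cons.prems by (auto simp: distinct_lines_def)
  then show ?case
    unfolding reduction.simps line_sum.simps using Cons.IH[OF cs]
    by (intro indep_mod_line) (auto split: nat.split)
qed

subsection \<open>Strictly decreasing reduction vectors\<close>

text \<open>In a strictly decreasing vector every entry is smaller by at least one than its predecessor, just as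
  the degree drops by one with each line; so all minima are attained by the entries once this holds
  for the first one.\<close>
lemma line_sum_eq_sum_list:
  assumes "sorted_wrt (>) ds" "ds \<noteq> [] \<Longrightarrow> hd ds \<le> Suc t"
  shows "line_sum ds t = sum_list ds"
  using assms
proof (induction ds arbitrary: t)
  case (Cons d ds)
  have d: "d \<le> Suc t" using Cons.prems(2) by simp
  have ds: "\<forall>x\<in>set ds. x < d" and sorted: "sorted_wrt (>) ds" using Cons.prems(1) by auto
  show ?case
  proof (cases t)
    case 0
    then have "\<forall>x\<in>set ds. x = 0" using ds d by fastforce
    then have "sum_list ds = 0" by simp
    then show ?thesis using 0 d by simp
  next
    case (Suc s)
    have "hd ds \<le> Suc s" if "ds \<noteq> []"
      using that ds d Suc hd_in_set[OF that] by fastforce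
    then show ?thesis using Cons.IH[OF sorted, of s] Suc d by simp
  qed
qed simp

text \<open>If \<open>t + 1\<close> is at least the first entry, then the sum is the degree of \<open>Z\<close>; otherwise its first term is
  \<open>t + 1\<close>, as in the estimate by the residual scheme.\<close>
lemma spans_mod_reduction:
  fixes cs :: "('k::field_char_0 ^ 3) list"
  assumes "distinct_lines cs" "sorted_wrt (>) (reduction cs Z)" "fat_degree Z = sum_list (reduction cs Z)"
  shows "poly3.spans_mod (homogeneous_part t) (fat_ideal Z \<inter> homogeneous_part t)
    (line_sum (reduction cs Z) t)"
  using assms
proof (induction cs arbitrary: t Z)
  case Nil
  then show ?case using spans_fat_degree[of t Z] by simp
next
  case (Cons c cs)
  have c: "c \<noteq> 0" and cs: "distinct_lines cs"
    using Cons.prems(1) by (auto simp: distinct_lines_def)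
  let ?d = "on_line (zeros c) Z" and ?Z = "residual (zeros c) Z"
  show ?case
  proof (cases "?d \<le> Suc t")
    case True
    then have "line_sum (reduction (c # cs) Z) t = fat_degree Z"
      using line_sum_eq_sum_list[OF Cons.prems(2), of t] Cons.prems(3) by simp
    then show ?thesis using spans_fat_degree[of t Z] by simp
  next
    case False
    have deg: "fat_degree ?Z = sum_list (reduction cs ?Z)"
      using Cons.prems(3) fat_degree_residual[of Z "zeros c"] by simp
    have IH: "poly3.spans_mod (homogeneous_part s) (fat_ideal ?Z \<inter> homogeneous_part s)
        (line_sum (reduction cs ?Z) s)" for s
      using Cons.IH[OF cs _ deg] Cons.prems(2) by simp
    show ?thesis
    proof (cases t)
      case 0
      then show ?thesis using spans_mod_degree_0[OF subspace_fat_part] False by simp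
    next
      case (Suc s)
      then show ?thesis using spans_mod_residual[OF c IH] False by simp
    qed
  qed
qed

theorem hilbert_fun_reduction:
  fixes cs :: "('k::field_char_0 ^ 3) list"
  assumes "distinct_lines cs" "sorted_wrt (>) (reduction cs Z)" "fat_degree Z = sum_list (reduction cs Z)"
  shows "hilbert_fun (fat_ideal Z) t = line_sum (reduction cs Z) t"
proof -
  obtain F where F: "finite F" "homogeneous_part t \<subseteq> poly3.span (F :: 'k poly3 set)"
    using finite_span_homogeneous .
  have "fat_ideal Z \<inter> homogeneous_part t \<subseteq> vanishing_on_lines cs Z"
    using fat_ideal_vanishing by (rule le_infI1)
  then have "poly3.indep_mod (homogeneous_part t) (fat_ideal Z \<inter> homogeneous_part t)
      (line_sum (reduction cs Z) t)"
    by (rule poly3.indep_mod_mono_sub[OF indep_mod_reduction[OF assms(1)]])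
  then show ?thesis
    unfolding hilbert_fun_def
    using poly3.quotient_dim_eqI[OF spans_mod_reduction[OF assms] _ subspace_homogeneous
        subspace_fat_part Int_lower2 F] by blast
qed


section \<open>Conjugates of valid Hilbert functions\<close>

lemma finite_interval_eq:
  fixes S :: "nat set"
  assumes "finite S" "\<And>j. j \<in> S \<Longrightarrow> a \<le> j" "\<And>i j. j \<in> S \<Longrightarrow> a \<le> i \<Longrightarrow> i \<le> j \<Longrightarrow> i \<in> S"
  shows "S = {a..<a + card S}"
proof (cases "S = {}")
  case False
  note Max = Max_in[OF assms(1) False] Max_ge[OF assms(1)]
  have "S = {a..Max S}"
  proof (intro equalityI subsetI)
    show "j \<in> {a..Max S}" if "j \<in> S" for j using that assms(2) Max(2) by simp
    show "j \<in> S" if "j \<in> {a..Max S}" for j using that assms(3)[OF Max(1), of j] by simp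
  qed
  moreover have "a \<le> Max S" using assms(2)[OF Max(1)] .
  ultimately have "card S = Suc (Max S) - a" by (metis card_atLeastAtMost)
  then have "a + card S = Suc (Max S)" using \<open>a \<le> Max S\<close> by simp
  with \<open>S = {a..Max S}\<close> show ?thesis by (metis atLeastLessThanSuc_atLeastAtMost)
qed simp

lemma sum_if_card: "finite A \<Longrightarrow> (\<Sum>x\<in>A. if P x then 1 else 0 :: nat) = card (A \<inter> {x. P x})"
  by (simp add: sum.If_cases)

context
  fixes h :: "nat list" and \<alpha> :: nat
  assumes valid: "valid_hilbert h \<alpha>"
begin

lemma valid_hilbert_le: "j < length h \<Longrightarrow> h ! j \<le> \<alpha>"
  using valid unfolding valid_hilbert_def by (cases "j < \<alpha>") auto

lemma valid_hilbert_initial: "j < \<alpha> \<Longrightarrow> j < length h \<and> h ! j = Suc j"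
  using valid unfolding valid_hilbert_def by auto

text \<open>The \<open>i\<close>-th row of the diagram of \<open>h\<close> starts in column \<open>i - 1\<close> and has no gaps, because \<open>h\<close> increases in
  steps of one up to \<open>\<alpha>\<close> and decreases afterwards.\<close>
lemma conjugate_interval:
  assumes "1 \<le> i" "i \<le> \<alpha>"
  shows "{j. j < length h \<and> h ! j \<ge> i} = {i - 1..<i - 1 + conjugate h i}"
  unfolding conjugate_def
proof (rule finite_interval_eq)
  fix j assume "j \<in> {j. j < length h \<and> h ! j \<ge> i}"
  then show "i - 1 \<le> j" using valid_hilbert_initial[of j] assms by (cases "j < \<alpha>") auto
next
  fix j' j assume j: "j \<in> {j. j < length h \<and> h ! j \<ge> i}" "i - 1 \<le> j'" "j' \<le> j"
  show "j' \<in> {j. j < length h \<and> h ! j \<ge> i}"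
  proof (cases "j' < \<alpha>")
    case True
    then show ?thesis using valid_hilbert_initial[of j'] j by auto
  next
    case False
    then have "h ! j \<le> h ! j'" using valid j unfolding valid_hilbert_def by auto
    then show ?thesis using j by auto
  qed
qed auto

text \<open>Column \<open>i - 1\<close> has height exactly \<open>i\<close>, so it belongs to row \<open>i\<close> and to no higher row.\<close>
lemma conjugate_strict_decreasing:
  assumes "1 \<le> i" "i < j" "j \<le> \<alpha>"
  shows "conjugate h j < conjugate h i"
  unfolding conjugate_def
proof (rule psubset_card_mono)
  have "i - 1 < length h" "h ! (i - 1) = i" using valid_hilbert_initial[of "i - 1"] assms by auto
  then have "i - 1 \<in> {k. k < length h \<and> h ! k \<ge> i} - {k. k < length h \<and> h ! k \<ge> j}"
    using assms by auto
  then show "{k. k < length h \<and> h ! k \<ge> j} \<subset> {k. k < length h \<and> h ! k \<ge> i}"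
    using assms by auto
qed simp

text \<open>The boxes in the columns \<open>0, \<dots>, t\<close> of the diagram are counted by rows.\<close>
lemma sum_hilbert_conjugate:
  "sum_hilbert h t = (\<Sum>i=1..\<alpha>. min (Suc t - (i - 1)) (conjugate h i))"
proof -
  have "sum_hilbert h t = (\<Sum>j\<le>t. \<Sum>i=1..\<alpha>. if j < length h \<and> i \<le> h ! j then 1 else 0)"
    unfolding sum_hilbert_def
  proof (intro sum.cong refl)
    fix j
    have "(\<Sum>i=1..\<alpha>. if j < length h \<and> i \<le> h ! j then 1 else 0 :: nat)
        = card ({1..\<alpha>} \<inter> {i. j < length h \<and> i \<le> h ! j})"
      by (rule sum_if_card) simp
    also have "{1..\<alpha>} \<inter> {i. j < length h \<and> i \<le> h ! j}
        = (if j < length h then {1..h ! j} else {})"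
      using valid_hilbert_le[of j] by auto
    finally show "(if j < length h then h ! j else 0)
        = (\<Sum>i=1..\<alpha>. if j < length h \<and> i \<le> h ! j then 1 else 0)" by simp
  qed
  also have "\<dots> = (\<Sum>i=1..\<alpha>. \<Sum>j\<le>t. if j < length h \<and> i \<le> h ! j then 1 else 0)"
    by (rule sum.swap)
  also have "\<dots> = (\<Sum>i=1..\<alpha>. min (Suc t - (i - 1)) (conjugate h i))"
  proof (intro sum.cong refl)
    fix i assume i: "i \<in> {1..\<alpha>}"
    have "(\<Sum>j\<le>t. if j < length h \<and> i \<le> h ! j then 1 else 0 :: nat)
        = card ({..t} \<inter> {j. j < length h \<and> i \<le> h ! j})"
      by (rule sum_if_card) simp
    also have "{..t} \<inter> {j. j < length h \<and> i \<le> h ! j} = {i - 1..<min (Suc t) (i - 1 + conjugate h i)}"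
      using i by (subst conjugate_interval) auto
    also have "card \<dots> = min (Suc t - (i - 1)) (conjugate h i)" by simp
    finally show "(\<Sum>j\<le>t. if j < length h \<and> i \<le> h ! j then 1 else 0)
        = min (Suc t - (i - 1)) (conjugate h i)" .
  qed
  finally show ?thesis .
qed

end

lemma line_sum_conv: "line_sum ds t = (\<Sum>i<length ds. min (Suc t - i) (ds ! i))"
proof (induction ds arbitrary: t)
  case (Cons d ds)
  have "(\<Sum>i<length (d # ds). min (Suc t - i) ((d # ds) ! i))
      = min (Suc t) d + (\<Sum>i<length ds. min (t - i) (ds ! i))"
    by (simp add: sum.lessThan_Suc_shift del: sum.lessThan_Suc)
  then show ?case using Cons.IH by (cases t) auto
qed simp

lemma line_sum_conjugate:
  assumes "valid_hilbert h \<alpha>"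
  shows "line_sum (map (conjugate h) [1..<Suc \<alpha>]) t = sum_hilbert h t"
proof -
  have "(\<Sum>i=1..\<alpha>. min (Suc t - (i - 1)) (conjugate h i))
      = (\<Sum>i<\<alpha>. min (Suc t - i) (conjugate h (Suc i)))"
    by (rule sum.reindex_bij_witness[of _ Suc "\<lambda>i. i - 1"]) auto
  then show ?thesis
    unfolding line_sum_conv sum_hilbert_conjugate[OF assms] by (simp del: upt_Suc)
qed

section \<open>Reduction vectors in closed form\<close>

text \<open>Before the \<open>n\<close>-th line is reached, a point has lost one multiplicity for each earlier line through it.\<close>
lemma reduction_conv:
  "reduction cs Z = map (\<lambda>n. \<Sum>P\<in>set_mset Z \<inter> zeros (cs ! n).
     count Z P - length (filter (\<lambda>c. incident c P) (take n cs))) [0..<length cs]"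
proof (induction cs arbitrary: Z)
  case (Cons c cs)
  let ?Z = "residual (zeros c) Z"
  have "(\<Sum>P\<in>set_mset ?Z \<inter> zeros (cs ! n). count ?Z P - length (filter (\<lambda>c. incident c P) (take n cs)))
      = (\<Sum>P\<in>set_mset Z \<inter> zeros (cs ! n).
          count Z P - length (filter (\<lambda>c. incident c P) (take (Suc n) (c # cs))))" for n
  proof (rule sum.mono_neutral_cong_left)
    show "set_mset ?Z \<inter> zeros (cs ! n) \<subseteq> set_mset Z \<inter> zeros (cs ! n)"
      unfolding residual_def by (auto dest: in_diffD)
    show "\<forall>P\<in>set_mset Z \<inter> zeros (cs ! n) - set_mset ?Z \<inter> zeros (cs ! n).
        count Z P - length (filter (\<lambda>c. incident c P) (take (Suc n) (c # cs))) = 0"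
    proof
      fix P assume "P \<in> set_mset Z \<inter> zeros (cs ! n) - set_mset ?Z \<inter> zeros (cs ! n)"
      then have "count ?Z P = 0" by (auto simp: not_in_iff)
      then show "count Z P - length (filter (\<lambda>c. incident c P) (take (Suc n) (c # cs))) = 0"
        by (auto simp: count_residual split: if_splits)
    qed
  qed (auto simp: count_residual)
  then show ?case
    using Cons.IH[of ?Z] by (simp add: on_line_def upt_conv_Cons map_Suc_upt[symmetric] del: upt_Suc)
qed simp

text \<open>Each point lies on so many of the lines that the final residual scheme is empty.\<close>
lemma fat_degree_reduction:
  assumes "\<And>P. count Z P \<le> length (filter (\<lambda>c. incident c P) cs)"
  shows "fat_degree Z = sum_list (reduction cs Z)"
  using assms
proof (induction cs arbitrary: Z)
  case Nil
  then have "Z = {#}" by (intro multiset_eqI) simp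
  then show ?case by (simp add: fat_degree_def)
next
  case (Cons c cs)
  have "count (residual (zeros c) Z) P \<le> length (filter (\<lambda>c. incident c P) cs)" for P
    using Cons.prems[of P] by (auto simp: count_residual split: if_splits)
  from Cons.IH[OF this] show ?case using fat_degree_residual[of Z "zeros c"] by simp
qed

section \<open>Lines in general position\<close>

text \<open>On the first line, the equation of the second one is a nonzero polynomial of degree at most one in an
  affine coordinate. It has a zero, possibly at infinity. Two zeros can both be made finite, so they
  coincide.\<close>
lemma lines_meet:
  fixes c c' :: "'k::field_char_0 ^ 3"
  assumes "c \<noteq> 0" "c' \<noteq> 0" "zeros c \<noteq> zeros c'"
  shows "\<exists>P. zeros c \<inter> zeros c' = {P}"
proof -
  have frame: "\<not> (dot c' a = 0 \<and> dot c' b = 0)" if "frame a b d y z c" for a b d y z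
    using frame_line_unique[OF that assms(2)] assms(3) by auto
  obtain a b d y z where fr: "frame a b d y z c" and "pt b \<notin> {}"
    using frame_line[OF assms(1) finite.emptyI] .
  have "\<exists>P. P \<in> zeros c \<inter> zeros c'"
  proof (cases "dot c' b = 0")
    case True
    have "dot c b = 0" using fr by (simp add: frame_def)
    then have "pt b \<in> zeros c \<inter> zeros c'"
      using True incident_pt[OF frame_nonzero(2)[OF fr]] by simp
    then show ?thesis by (rule exI)
  next
    case False
    define x where "x = - dot c' a / dot c' b"
    have "dot c' (a + x *s b) = 0"
      unfolding dot_add_right dot_scale_right x_def using False by simp
    then have "pt (a + x *s b) \<in> zeros c \<inter> zeros c'"
      using incident_pt[OF frame_nonzero(1)[OF fr]] frame_dot_line[OF fr] by simp
    then show ?thesis by (rule exI)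
  qed
  then obtain P where P: "P \<in> zeros c \<inter> zeros c'" ..
  have "Q = P" if Q: "Q \<in> zeros c \<inter> zeros c'" for Q
  proof (rule ccontr)
    assume "Q \<noteq> P"
    have "finite {P, Q}" by simp
    then obtain a b d y z where fr: "frame a b d y z c" and b: "pt b \<notin> {P, Q}"
      by (rule frame_line[OF assms(1)])
    obtain x where x: "P = pt (a + x *s b)"
      by (rule frame_line_point[OF fr, of P]) (use P b in auto)
    obtain x' where x': "Q = pt (a + x' *s b)"
      by (rule frame_line_point[OF fr, of Q]) (use Q b in auto)
    have 1: "dot c' a + x * dot c' b = 0" "dot c' a + x' * dot c' b = 0"
      using P Q incident_pt[OF frame_nonzero(1)[OF fr]]
      unfolding x x' dot_add_right[symmetric] dot_scale_right[symmetric] by simp_all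
    then have "(x - x') * dot c' b = 0" by algebra
    moreover have "x \<noteq> x'" using \<open>Q \<noteq> P\<close> x x' by auto
    ultimately have "dot c' b = 0" by simp
    then show False using 1 frame[OF fr] by simp
  qed
  then show ?thesis using P by (intro exI[of _ P]) blast
qed

lemma infinite_zeros:
  fixes c :: "'k::field_char_0 ^ 3"
  assumes "c \<noteq> 0"
  shows "infinite (zeros c)"
proof -
  obtain a b d y z where fr: "frame a b d y z c" and "pt b \<notin> {}"
    using frame_line[OF assms finite.emptyI] .
  have "inj (\<lambda>x. pt (a + x *s b))" using pt_line_inj[OF fr] by (rule injI)
  then have "infinite (range (\<lambda>x. pt (a + x *s b)))"
    using infinite_UNIV_char_0[where 'a = 'k] by (simp add: finite_image_iff)
  moreover have "range (\<lambda>x. pt (a + x *s b)) \<subseteq> zeros c"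
    using incident_pt[OF frame_nonzero(1)[OF fr]] frame_dot_line[OF fr] by auto
  ultimately show ?thesis by (rule infinite_super[rotated])
qed

text \<open>The lines are tangent to a conic: a point on three of them would give a nonzero polynomial of degree
  at most two with three roots.\<close>
lemma general_lines_exist:
  "\<exists>l :: nat \<Rightarrow> 'k::field_char_0 proj_plane set. general_lines \<alpha> l"
proof -
  define c :: "nat \<Rightarrow> 'k ^ 3" where "c i = vector [1, of_nat i, of_nat i ^ 2]" for i
  have dot: "dot (c i) v = v $ 1 + of_nat i * v $ 2 + of_nat i ^ 2 * v $ 3" for i v
    by (simp add: c_def dot_def sum_3 vector_3)
  have nz: "c i \<noteq> 0" for i by (simp add: c_def vec_eq_iff forall_3 vector_3)
  have inj: "i = j" if "zeros (c i) = zeros (c j)" for i j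
  proof -
    define v :: "'k ^ 3" where "v = vector [- of_nat i, 1, 0]"
    have v: "v \<noteq> 0" by (simp add: v_def vec_eq_iff forall_3 vector_3)
    have "pt v \<in> zeros (c i)" using v by (simp add: incident_pt dot) (simp add: v_def vector_3)
    then have "pt v \<in> zeros (c j)" using that by simp
    then have "of_nat j = (of_nat i :: 'k)"
      using v by (simp add: incident_pt dot) (simp add: v_def vector_3)
    then show ?thesis by simp
  qed
  have three: "zeros (c i) \<inter> zeros (c j) \<inter> zeros (c k) = {}" if ijk: "i \<noteq> j" "j \<noteq> k" "i \<noteq> k" for i j k
  proof (rule ccontr)
    assume "zeros (c i) \<inter> zeros (c j) \<inter> zeros (c k) \<noteq> {}"
    then obtain P where P: "incident (c i) P" "incident (c j) P" "incident (c k) P" by blast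
    define v where "v = rep_proj_plane P"
    have v: "dot (c i) v = 0" "dot (c j) v = 0" "dot (c k) v = 0" "v \<noteq> 0"
      using P by (simp_all add: v_def incident_rep rep_nonzero)
    have "(of_nat i - of_nat j) * (v $ 2 + (of_nat i + of_nat j) * v $ 3) = 0"
      using v(1,2) unfolding dot by algebra
    then have 1: "v $ 2 + (of_nat i + of_nat j) * v $ 3 = 0" using ijk by simp
    have "(of_nat i - of_nat k) * (v $ 2 + (of_nat i + of_nat k) * v $ 3) = 0"
      using v(1,3) unfolding dot by algebra
    then have 2: "v $ 2 + (of_nat i + of_nat k) * v $ 3 = 0" using ijk by simp
    have "(of_nat j - of_nat k) * v $ 3 = 0" using 1 2 by algebra
    then have 3: "v $ 3 = 0" using ijk by simp
    then have "v $ 2 = 0" using 1 by simp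
    then have "v $ 1 = 0" using v(1) 3 unfolding dot by simp
    with 3 \<open>v $ 2 = 0\<close> v(4) show False by (simp add: vec_eq_iff forall_3)
  qed
  have "general_lines \<alpha> (\<lambda>i. zeros (c i))"
    unfolding general_lines_def is_line_def
  proof (intro conjI ballI impI)
    show "\<exists>a. a \<noteq> 0 \<and> zeros (c i) = {P. incident a P}" for i using nz by blast
    show "inj_on (\<lambda>i. zeros (c i)) {1..\<alpha>}" using inj by (rule inj_onI)
    show "zeros (c i) \<inter> zeros (c j) \<inter> zeros (c k) = {}" if "i \<noteq> j \<and> j \<noteq> k \<and> i \<noteq> k" for i j k
      using three that by blast
  qed
  then show ?thesis by (rule exI[of _ "\<lambda>i. zeros (c i)"])
qed


section \<open>Schemes of reduced points and double crossings\<close>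

context
  fixes \<alpha> :: nat and l :: "nat \<Rightarrow> 'k::field_char_0 proj_plane set"
  assumes general: "general_lines \<alpha> l"
begin

lemma line_forms:
  obtains c where "\<forall>i\<in>{1..\<alpha>}. c i \<noteq> 0 \<and> l i = zeros (c i)"
proof -
  have "\<forall>i\<in>{1..\<alpha>}. \<exists>c. c \<noteq> 0 \<and> l i = zeros c"
    using general unfolding general_lines_def is_line_def by blast
  from bchoice[OF this] show thesis using that by blast
qed

lemma lines_eq_iff: "i \<in> {1..\<alpha>} \<Longrightarrow> j \<in> {1..\<alpha>} \<Longrightarrow> l i = l j \<longleftrightarrow> i = j"
  using general unfolding general_lines_def inj_on_def by blast

lemma crossing_eq:
  assumes "i \<in> {1..\<alpha>}" "j \<in> {1..\<alpha>}" "i \<noteq> j"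
  shows "l i \<inter> l j = {crossing l i j}"
proof -
  obtain c where *: "\<forall>i\<in>{1..\<alpha>}. c i \<noteq> 0 \<and> l i = zeros (c i)" by (rule line_forms)
  then have c: "i \<in> {1..\<alpha>} \<Longrightarrow> c i \<noteq> 0" "i \<in> {1..\<alpha>} \<Longrightarrow> l i = zeros (c i)" for i by blast+
  have "zeros (c i) \<noteq> zeros (c j)" using lines_eq_iff assms c(2) by metis
  then obtain P where "l i \<inter> l j = {P}" using lines_meet[OF c(1)[OF assms(1)] c(1)[OF assms(2)]] c(2) assms by auto
  then show ?thesis by (simp add: crossing_def)
qed

lemma crossing_on_line:
  assumes "i \<in> {1..\<alpha>}" "j \<in> {1..\<alpha>}" "i \<noteq> j" "k \<in> {1..\<alpha>}"
  shows "crossing l i j \<in> l k \<longleftrightarrow> k = i \<or> k = j"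
proof -
  have *: "crossing l i j \<in> l i" "crossing l i j \<in> l j" using crossing_eq[OF assms(1-3)] by auto
  moreover have "l i \<inter> l j \<inter> l k = {}" if "k \<noteq> i" "k \<noteq> j"
    using general that assms unfolding general_lines_def by metis
  ultimately show ?thesis by blast
qed

abbreviation (input) pairs :: "(nat \<times> nat) set" where
  "pairs \<equiv> {(i, j). 1 \<le> i \<and> i < j \<and> j \<le> \<alpha>}"

abbreviation (input) cross :: "nat \<times> nat \<Rightarrow> 'k proj_plane" where
  "cross p \<equiv> crossing l (fst p) (snd p)"

lemma cross_on_line: "p \<in> pairs \<Longrightarrow> k \<in> {1..\<alpha>} \<Longrightarrow> cross p \<in> l k \<longleftrightarrow> k = fst p \<or> k = snd p"
  by (rule crossing_on_line) auto

lemma cross_inj: "inj_on cross pairs"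
proof (rule inj_onI)
  fix p q assume pq: "p \<in> pairs" "q \<in> pairs" "cross p = cross q"
  have "k = fst p \<or> k = snd p \<longleftrightarrow> k = fst q \<or> k = snd q" if "k \<in> {1..\<alpha>}" for k
    using cross_on_line[OF pq(1) that] cross_on_line[OF pq(2) that] pq(3) by simp
  from this[of "fst p"] this[of "snd p"] show "p = q" using pq(1,2) by (auto simp: prod_eq_iff)
qed

definition off_crossings :: "'k proj_plane set \<Rightarrow> bool" where
  "off_crossings Y \<longleftrightarrow> finite Y \<and> Y \<subseteq> (\<Union>i\<in>{1..\<alpha>}. l i) \<and>
     (\<forall>i\<in>{1..\<alpha>}. \<forall>j\<in>{1..\<alpha>}. i \<noteq> j \<longrightarrow> Y \<inter> (l i \<inter> l j) = {})"

lemma off_crossings_exists: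
  "\<exists>X. off_crossings X \<and> (\<forall>i\<in>{1..\<alpha>}. card (X \<inter> l i) = e i)"
proof -
  obtain c where *: "\<forall>i\<in>{1..\<alpha>}. c i \<noteq> 0 \<and> l i = zeros (c i)" by (rule line_forms)
  then have c: "i \<in> {1..\<alpha>} \<Longrightarrow> c i \<noteq> 0" "i \<in> {1..\<alpha>} \<Longrightarrow> l i = zeros (c i)" for i by blast+
  have "\<forall>i\<in>{1..\<alpha>}. \<exists>T. finite T \<and> card T = e i \<and> T \<subseteq> l i - (\<Union>j\<in>{1..\<alpha>} - {i}. l j)"
  proof
    fix i assume i: "i \<in> {1..\<alpha>}"
    have "infinite (l i)" using infinite_zeros[OF c(1)[OF i]] c(2)[OF i] by simp
    moreover have "finite (\<Union>j\<in>{1..\<alpha>} - {i}. l i \<inter> l j)" using crossing_eq[OF i] by auto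
    ultimately have "infinite (l i - (\<Union>j\<in>{1..\<alpha>} - {i}. l i \<inter> l j))" by (rule Diff_infinite_finite[rotated])
    moreover have "l i - (\<Union>j\<in>{1..\<alpha>} - {i}. l i \<inter> l j) = l i - (\<Union>j\<in>{1..\<alpha>} - {i}. l j)" by blast
    ultimately show "\<exists>T. finite T \<and> card T = e i \<and> T \<subseteq> l i - (\<Union>j\<in>{1..\<alpha>} - {i}. l j)"
      using infinite_arbitrarily_large by metis
  qed
  then obtain T where T: "\<forall>i\<in>{1..\<alpha>}. finite (T i) \<and> card (T i) = e i \<and>
      T i \<subseteq> l i - (\<Union>j\<in>{1..\<alpha>} - {i}. l j)" by (rule bchoice[THEN exE])
  then have on: "P \<in> l k \<longleftrightarrow> k = i" if "P \<in> T i" "i \<in> {1..\<alpha>}" "k \<in> {1..\<alpha>}" for P i k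
    using that by blast
  let ?X = "\<Union>i\<in>{1..\<alpha>}. T i"
  have "off_crossings ?X"
    unfolding off_crossings_def
  proof (intro conjI ballI impI)
    show "finite ?X" using T by simp
    show "?X \<subseteq> (\<Union>i\<in>{1..\<alpha>}. l i)" using on by blast
    show "?X \<inter> (l i \<inter> l j) = {}" if "i \<in> {1..\<alpha>}" "j \<in> {1..\<alpha>}" "i \<noteq> j" for i j
      using that on by blast
  qed
  moreover have "?X \<inter> l i = T i" if "i \<in> {1..\<alpha>}" for i using that on by blast
  ultimately show ?thesis using T by (intro exI[of _ ?X]) simp
qed

text \<open>The schemes that occur in the procedure: reduced points \<open>Y\<close> together with a double point at each
  crossing indexed by \<open>D\<close>.\<close>
definition scheme :: "'k proj_plane set \<Rightarrow> (nat \<times> nat) set \<Rightarrow> 'k fat_points" where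
  "scheme Y D = mset_set Y + (\<Sum>p\<in>D. replicate_mset 2 (cross p))"

lemma finite_pairs: "D \<subseteq> pairs \<Longrightarrow> finite D"
  by (rule finite_subset[of _ "{1..\<alpha>} \<times> {1..\<alpha>}"]) auto

lemma off_crossings_unique_line:
  assumes "off_crossings Y" "P \<in> Y" "i \<in> {1..\<alpha>}" "P \<in> l i" "k \<in> {1..\<alpha>}"
  shows "P \<in> l k \<longleftrightarrow> k = i"
  using assms unfolding off_crossings_def by blast

lemma off_crossings_no_cross:
  assumes "off_crossings Y" "p \<in> pairs"
  shows "cross p \<notin> Y"
proof
  assume "cross p \<in> Y"
  then have "cross p \<in> l (snd p) \<longleftrightarrow> snd p = fst p"
    using cross_on_line[OF assms(2)] assms by (intro off_crossings_unique_line[OF assms(1)]) auto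
  then show False using cross_on_line[OF assms(2), of "snd p"] assms(2) by auto
qed

lemma count_scheme:
  assumes "off_crossings Y" "D \<subseteq> pairs"
  shows "count (scheme Y D) P = (if P \<in> Y then 1 else if P \<in> cross ` D then 2 else 0)"
proof -
  have finD: "finite D" by (rule finite_pairs[OF assms(2)])
  have finY: "finite Y" using assms(1) by (simp add: off_crossings_def)
  have "count (\<Sum>p\<in>D. replicate_mset 2 (cross p)) P = (\<Sum>p\<in>D. if cross p = P then 2 else 0)"
    by (simp add: count_sum eq_commute)
  also have "\<dots> = (if P \<in> cross ` D then 2 else 0)"
  proof (cases "P \<in> cross ` D")
    case True
    then obtain q where q: "q \<in> D" "P = cross q" by blast
    have "(\<Sum>p\<in>D. if cross p = P then 2 else 0) = (\<Sum>p\<in>D. if p = q then 2 else 0 :: nat)"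
      using q assms(2) inj_on_eq_iff[OF inj_on_subset[OF cross_inj assms(2)]] by (intro sum.cong) auto
    then show ?thesis using True q finD by simp
  next
    case False
    then have "(\<Sum>p\<in>D. if cross p = P then 2 else 0) = (0::nat)" by (intro sum.neutral) auto
    then show ?thesis using False by simp
  qed
  finally show ?thesis
    using finY off_crossings_no_cross[OF assms(1)] assms(2) by (auto simp: scheme_def count_mset_set')
qed

lemma count_scheme_cross:
  assumes "off_crossings Y" "D \<subseteq> pairs" "p \<in> D"
  shows "count (scheme Y D) (cross p) = 2"
proof -
  have "cross p \<in> cross ` D" "cross p \<notin> Y"
    using assms off_crossings_no_cross[OF assms(1), of p] by blast+
  then show ?thesis by (simp only: count_scheme[OF assms(1,2)] if_True if_False)
qed

lemma set_scheme:
  assumes "off_crossings Y" "D \<subseteq> pairs"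
  shows "set_mset (scheme Y D) = Y \<union> cross ` D"
  using count_scheme[OF assms] by (auto simp: set_mset_def split: if_splits)

text \<open>The entry of line \<open>n\<close> in the reduction vector. When line \<open>n\<close> is reached, a double point on it is still
  double if \<open>n\<close> is the smaller one of its indices, and has become reduced if \<open>n\<close> is the larger one.\<close>
lemma scheme_on_line:
  assumes Y: "off_crossings Y" and D: "D \<subseteq> pairs" and n: "n \<in> {1..\<alpha>}"
  shows "(\<Sum>P\<in>set_mset (scheme Y D) \<inter> l n. count (scheme Y D) P - card ({i. P \<in> l i} \<inter> {1..<n}))
    = card (Y \<inter> l n) + 2 * card {p \<in> D. fst p = n} + card {p \<in> D. snd p = n}"
proof -
  let ?f = "\<lambda>P. count (scheme Y D) P - card ({i. P \<in> l i} \<inter> {1..<n})"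
  let ?D = "{p \<in> D. fst p = n} \<union> {p \<in> D. snd p = n}"
  have finY: "finite Y" using Y by (simp add: off_crossings_def)
  have finD: "finite D" by (rule finite_pairs[OF D])
  have inj: "inj_on cross ?D" using D by (intro inj_on_subset[OF cross_inj]) auto
  have "set_mset (scheme Y D) \<inter> l n = (Y \<inter> l n) \<union> cross ` ?D"
  proof -
    have "{p \<in> D. cross p \<in> l n} = ?D" using cross_on_line[OF _ n] D by blast
    then have "cross ` D \<inter> l n = cross ` ?D" by blast
    then show ?thesis unfolding set_scheme[OF Y D] by (simp only: Int_Un_distrib2)
  qed
  moreover have "(Y \<inter> l n) \<inter> cross ` ?D = {}" using off_crossings_no_cross[OF Y] D by blast
  ultimately have "(\<Sum>P\<in>set_mset (scheme Y D) \<inter> l n. ?f P)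
      = (\<Sum>P\<in>Y \<inter> l n. ?f P) + (\<Sum>P\<in>cross ` ?D. ?f P)"
    using finY finD by (simp add: sum.union_disjoint)
  also have "(\<Sum>P\<in>Y \<inter> l n. ?f P) = (\<Sum>P\<in>Y \<inter> l n. 1)"
  proof (intro sum.cong refl)
    fix P assume P: "P \<in> Y \<inter> l n"
    have "{i. P \<in> l i} \<inter> {1..<n} = {}"
      using off_crossings_unique_line[OF Y, of P n] P n by auto
    then show "?f P = 1" using P by (simp add: count_scheme[OF Y D])
  qed
  also have "(\<Sum>P\<in>cross ` ?D. ?f P) = (\<Sum>p\<in>?D. ?f (cross p))"
    by (simp add: sum.reindex[OF inj])
  also have "\<dots> = (\<Sum>p\<in>{p \<in> D. fst p = n}. ?f (cross p)) + (\<Sum>p\<in>{p \<in> D. snd p = n}. ?f (cross p))"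
    using finD D by (intro sum.union_disjoint) auto
  also have "(\<Sum>p\<in>{p \<in> D. fst p = n}. ?f (cross p)) = (\<Sum>p\<in>{p \<in> D. fst p = n}. 2)"
  proof (intro sum.cong refl)
    fix p assume p: "p \<in> {p \<in> D. fst p = n}"
    then have pp: "p \<in> pairs" using D by blast
    have "{i. cross p \<in> l i} \<inter> {1..<n} = {}" using cross_on_line[OF pp] pp p n by auto
    moreover have "count (scheme Y D) (cross p) = 2" using count_scheme_cross[OF Y D] p by blast
    ultimately show "?f (cross p) = 2" by (simp only: card.empty diff_zero)
  qed
  also have "(\<Sum>p\<in>{p \<in> D. snd p = n}. ?f (cross p)) = (\<Sum>p\<in>{p \<in> D. snd p = n}. 1)"
  proof (intro sum.cong refl)
    fix p assume p: "p \<in> {p \<in> D. snd p = n}"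
    then have pp: "p \<in> pairs" using D by blast
    have "{i. cross p \<in> l i} \<inter> {1..<n} = {fst p}" using cross_on_line[OF pp] pp p n by auto
    moreover have "count (scheme Y D) (cross p) = 2" using count_scheme_cross[OF Y D] p by blast
    ultimately show "?f (cross p) = 1" by simp
  qed
  finally show ?thesis by simp
qed

lemma hilbert_fun_scheme:
  assumes Y: "off_crossings Y" and D: "D \<subseteq> pairs"
    and e: "\<And>n. n \<in> {1..\<alpha>} \<Longrightarrow>
      card (Y \<inter> l n) + 2 * card {p \<in> D. fst p = n} + card {p \<in> D. snd p = n} = e n"
    and dec: "\<And>i j. 1 \<le> i \<Longrightarrow> i < j \<Longrightarrow> j \<le> \<alpha> \<Longrightarrow> e j < e i"
  shows "hilbert_fun (fat_ideal (scheme Y D)) t = line_sum (map e [1..<Suc \<alpha>]) t"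
proof -
  obtain c where *: "\<forall>i\<in>{1..\<alpha>}. c i \<noteq> 0 \<and> l i = zeros (c i)" by (rule line_forms)
  then have c: "i \<in> {1..\<alpha>} \<Longrightarrow> c i \<noteq> 0" "i \<in> {1..\<alpha>} \<Longrightarrow> l i = zeros (c i)" for i by blast+
  let ?cs = "map c [1..<Suc \<alpha>]"
  have passes: "length (filter (\<lambda>c. incident c P) (map c [1..<Suc n])) = card ({i. P \<in> l i} \<inter> {1..n})"
    if "n \<le> \<alpha>" for n P
  proof -
    have "length (filter (\<lambda>c. incident c P) (map c [1..<Suc n]))
        = card ({i. incident (c i) P} \<inter> {1..n})"
      by (simp add: filter_map o_def distinct_length_filter atLeastLessThanSuc_atLeastAtMost del: upt_Suc)
    also have "{i. incident (c i) P} \<inter> {1..n} = {i. P \<in> l i} \<inter> {1..n}"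
      using c(2) that by auto
    finally show ?thesis .
  qed
  have "reduction ?cs (scheme Y D) = map e [1..<Suc \<alpha>]"
  proof (rule nth_equalityI)
    show "length (reduction ?cs (scheme Y D)) = length (map e [1..<Suc \<alpha>])"
      by (simp add: reduction_conv del: upt_Suc)
  next
    fix i assume "i < length (reduction ?cs (scheme Y D))"
    then have i: "i < \<alpha>" by (simp add: reduction_conv del: upt_Suc)
    then have n: "Suc i \<in> {1..\<alpha>}" by simp
    have "take i ?cs = map c [1..<Suc i]" using i by (simp add: take_map take_upt del: upt_Suc)
    then have "reduction ?cs (scheme Y D) ! i
        = (\<Sum>P\<in>set_mset (scheme Y D) \<inter> l (Suc i).
            count (scheme Y D) P - card ({i. P \<in> l i} \<inter> {1..<Suc i}))"
      using i c(2)[OF n] passes[of i]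
      by (simp add: reduction_conv atLeastLessThanSuc_atLeastAtMost del: upt_Suc)
    then show "reduction ?cs (scheme Y D) ! i = map e [1..<Suc \<alpha>] ! i"
      using scheme_on_line[OF Y D n] e[OF n] i by (simp del: upt_Suc)
  qed
  moreover have "distinct_lines ?cs"
    unfolding distinct_lines_def
  proof
    show "0 \<notin> set ?cs" using c(1) by (auto simp del: upt_Suc)
    have "inj_on (\<lambda>i. zeros (c i)) {1..\<alpha>}"
      using lines_eq_iff c(2) by (intro inj_onI) (metis (no_types, lifting))
    then show "distinct (map zeros ?cs)"
      by (simp add: distinct_map o_def atLeastLessThanSuc_atLeastAtMost comp_inj_on_iff del: upt_Suc)
  qed
  moreover have "sorted_wrt (>) (map e [1..<Suc \<alpha>])"
    using dec by (auto simp: sorted_wrt_iff_nth_less simp del: upt_Suc)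
  moreover have "fat_degree (scheme Y D) = sum_list (reduction ?cs (scheme Y D))"
  proof (rule fat_degree_reduction)
    fix P
    have "count (scheme Y D) P \<le> card ({i. P \<in> l i} \<inter> {1..\<alpha>})"
    proof (cases "P \<in> Y")
      case True
      then have "{i. P \<in> l i} \<inter> {1..\<alpha>} \<noteq> {}" using Y unfolding off_crossings_def by blast
      then have "0 < card ({i. P \<in> l i} \<inter> {1..\<alpha>})" by (simp add: card_gt_0_iff)
      then show ?thesis using True by (simp add: count_scheme[OF Y D])
    next
      case False
      have "2 \<le> card ({i. cross p \<in> l i} \<inter> {1..\<alpha>})" if "p \<in> D" for p
      proof -
        have pp: "p \<in> pairs" using that D by blast
        have "{i. cross p \<in> l i} \<inter> {1..\<alpha>} = {fst p, snd p}" using cross_on_line[OF pp] pp by auto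
        then show ?thesis using pp by (auto simp: card_insert_if)
      qed
      then show ?thesis using False by (auto simp: count_scheme[OF Y D])
    qed
    then show "count (scheme Y D) P \<le> length (filter (\<lambda>c. incident c P) ?cs)"
      using passes[of \<alpha>] by simp
  qed
  ultimately show ?thesis using hilbert_fun_reduction[of ?cs "scheme Y D" t] by simp
qed

end


section \<open>The procedure\<close>

lemma card_Diff_Int:
  assumes "finite Y" "B \<subseteq> Y"
  shows "card ((Y - B) \<inter> L) + card (B \<inter> L) = card (Y \<inter> L)"
proof -
  have "Y \<inter> L = (Y - B) \<inter> L \<union> B \<inter> L" using assms(2) by blast
  moreover have "finite B" using assms by (rule finite_subset[rotated])
  moreover have "((Y - B) \<inter> L) \<inter> (B \<inter> L) = {}" by blast
  ultimately show ?thesis using assms(1) by (simp add: card_Un_disjoint)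
qed

lemma card_Collect_Un:
  assumes "finite A" "finite B" "A \<inter> B = {}"
  shows "card {q \<in> A \<union> B. Q q} = card {q \<in> A. Q q} + card {q \<in> B. Q q}"
proof -
  have "{q \<in> A \<union> B. Q q} = {q \<in> A. Q q} \<union> {q \<in> B. Q q}" by blast
  moreover have "{q \<in> A. Q q} \<inter> {q \<in> B. Q q} = {}" using assms(3) by blast
  ultimately show ?thesis using assms(1,2) by (simp add: card_Un_disjoint)
qed

context
  fixes h :: "nat list" and \<alpha> :: nat
  assumes valid: "valid_hilbert h \<alpha>"
begin

lemma s_par_le: "s_par h \<alpha> n \<le> \<alpha> - n"
proof -
  have "s_par h \<alpha> n \<le> card {n + 1..\<alpha>}" unfolding s_par_def by (rule card_mono) auto
  then show ?thesis by simp
qed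

text \<open>The conjugate decreases, so the \<open>k\<close> counted by \<open>s\<^sub>n\<close> are consecutive, starting with \<open>n + 1\<close>.\<close>
lemma s_par_initial:
  assumes "n + 1 \<le> j" "j \<le> n + s_par h \<alpha> n"
  shows "n \<le> conjugate h j"
proof (rule ccontr)
  assume lt: "\<not> n \<le> conjugate h j"
  have "{k. n + 1 \<le> k \<and> k \<le> \<alpha> \<and> conjugate h k \<ge> n} \<subseteq> {n + 1..<j}"
  proof safe
    fix k assume k: "n + 1 \<le> k" "k \<le> \<alpha>" "conjugate h k \<ge> n"
    have "\<not> j < k" using conjugate_strict_decreasing[OF valid, of j k] assms(1) k lt by auto
    then show "k \<in> {n + 1..<j}" using k lt by (cases "k = j") auto
  qed
  then have "s_par h \<alpha> n \<le> card {n + 1..<j}" unfolding s_par_def by (rule card_mono[rotated]) simp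
  then show False using assms by simp
qed

text \<open>The indices of the double points that are added in the steps \<open>1, \<dots>, n\<close>.\<close>
definition double_pairs :: "nat \<Rightarrow> (nat \<times> nat) set" where
  "double_pairs n = (SIGMA i:{1..n}. {i + 1..i + t_par h \<alpha> i})"

lemma double_pairs_bound: "1 \<le> i \<Longrightarrow> i < j \<Longrightarrow> j \<le> i + t_par h \<alpha> i \<Longrightarrow> j \<le> \<alpha>"
  using s_par_le[of i] unfolding t_par_def by simp

lemma double_pairs_subset: "double_pairs n \<subseteq> {(i, j). 1 \<le> i \<and> i < j \<and> j \<le> \<alpha>}"
proof clarify
  fix i j assume "(i, j) \<in> double_pairs n"
  then have "1 \<le> i" "i < j" "j \<le> i + t_par h \<alpha> i" by (auto simp: double_pairs_def)
  with double_pairs_bound[OF this] show "1 \<le> i \<and> i < j \<and> j \<le> \<alpha>" by blast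
qed

lemma finite_double_pairs: "finite (double_pairs n)"
  unfolding double_pairs_def by simp

lemma double_pairs_Suc:
  "double_pairs (Suc n) = double_pairs n \<union> Pair (Suc n) ` {Suc n + 1..Suc n + t_par h \<alpha> (Suc n)}"
  unfolding double_pairs_def by (auto simp: le_Suc_eq)

lemma double_pairs_Suc_disjoint:
  "double_pairs n \<inter> Pair (Suc n) ` {Suc n + 1..Suc n + t_par h \<alpha> (Suc n)} = {}"
  unfolding double_pairs_def by auto

lemma double_pairs_fst: "n < k \<Longrightarrow> {p \<in> double_pairs n. fst p = k} = {}"
  unfolding double_pairs_def by auto

lemma double_pairs_snd: "card {p \<in> double_pairs n. snd p = k} \<le> n"
proof -
  have "{p \<in> double_pairs n. snd p = k} \<subseteq> (\<lambda>i. (i, k)) ` {1..n}"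
    unfolding double_pairs_def by auto
  then have "card {p \<in> double_pairs n. snd p = k} \<le> card {1..n}" by (rule surj_card_le[rotated]) simp
  then show ?thesis by simp
qed

context
  fixes l :: "nat \<Rightarrow> 'k::field_char_0 proj_plane set"
  assumes general: "general_lines \<alpha> l"
begin

text \<open>The invariant of the procedure: by \<open>scheme_on_line\<close> it says that the scheme after step \<open>n\<close> has
  reduction vector \<open>\<Delta>H\<^sup>\<star>\<close>.\<close>
definition balanced :: "nat \<Rightarrow> 'k proj_plane set \<Rightarrow> bool" where
  "balanced n Y \<longleftrightarrow> off_crossings \<alpha> l Y \<and> (\<forall>k\<in>{1..\<alpha>}. card (Y \<inter> l k)
     + 2 * card {p \<in> double_pairs n. fst p = k} + card {p \<in> double_pairs n. snd p = k} = conjugate h k)"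

lemma balanced_count:
  assumes "balanced n Y"
  shows "count (scheme l Y (double_pairs n)) P
    = (if P \<in> Y then 1 else if P \<in> (\<lambda>p. crossing l (fst p) (snd p)) ` double_pairs n then 2 else 0)"
  using assms count_scheme[OF general _ double_pairs_subset] unfolding balanced_def by blast

lemma balanced_reduced:
  "balanced n Y \<Longrightarrow> reduced_points (scheme l Y (double_pairs n)) = Y"
  unfolding reduced_points_def by (auto simp: balanced_count split: if_splits)

lemma balanced_support:
  "balanced n Y \<Longrightarrow> set_mset (scheme l Y (double_pairs n))
    = reduced_points (scheme l Y (double_pairs n)) \<union> double_points (scheme l Y (double_pairs n))"
  unfolding reduced_points_def double_points_def set_mset_def
  by (auto simp: balanced_count split: if_splits)

lemma balanced_hilbert_fun:
  assumes "balanced n Y"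
  shows "hilbert_fun (fat_ideal (scheme l Y (double_pairs n))) = sum_hilbert h"
proof
  fix t
  have "hilbert_fun (fat_ideal (scheme l Y (double_pairs n))) t
      = line_sum (map (conjugate h) [1..<Suc \<alpha>]) t"
    using assms conjugate_strict_decreasing[OF valid] unfolding balanced_def
    by (intro hilbert_fun_scheme[OF general _ double_pairs_subset]) auto
  then show "hilbert_fun (fat_ideal (scheme l Y (double_pairs n))) t = sum_hilbert h t"
    using line_sum_conjugate[OF valid] by simp
qed

lemma balanced_initial:
  assumes "initial h \<alpha> l Z"
  shows "\<exists>X. balanced 0 X \<and> Z = scheme l X (double_pairs 0)"
proof -
  obtain X where X: "off_crossings \<alpha> l X" "\<forall>i\<in>{1..\<alpha>}. card (X \<inter> l i) = conjugate h i"
    and Z: "Z = mset_set X"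
    using assms unfolding initial_def off_crossings_def[OF general] by metis
  have D: "double_pairs 0 = {}" by (simp add: double_pairs_def)
  have "balanced 0 X" unfolding balanced_def D using X by simp
  moreover have "Z = scheme l X (double_pairs 0)" unfolding D by (simp add: Z scheme_def[OF general])
  ultimately show ?thesis by blast
qed

text \<open>Each of the first \<open>n\<close> steps has removed at most one point from a line that is still to be
  processed.\<close>
lemma balanced_card_ge:
  assumes "balanced n Y" "n < k" "k \<le> \<alpha>"
  shows "conjugate h k - n \<le> card (Y \<inter> l k)"
proof -
  have "card {p \<in> double_pairs n. fst p = k} = 0" unfolding double_pairs_fst[OF assms(2)] by simp
  moreover have "card (Y \<inter> l k) + 2 * card {p \<in> double_pairs n. fst p = k}
      + card {p \<in> double_pairs n. snd p = k} = conjugate h k"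
    using assms unfolding balanced_def by auto
  ultimately show ?thesis using double_pairs_snd[of n k] by simp
qed

text \<open>On line \<open>n + 1\<close> the \<open>2t\<close> removed points are replaced by \<open>t\<close> new double points that count twice, and on
  each of the next \<open>t\<close> lines one removed point is replaced by a double point that counts once.\<close>
lemma balanced_step:
  assumes "balanced n Y" and st: "step h \<alpha> l (n + 1) (scheme l Y (double_pairs n)) Z'"
  shows "\<exists>Y'. balanced (n + 1) Y' \<and> Z' = scheme l Y' (double_pairs (n + 1))"
proof -
  let ?t = "t_par h \<alpha> (Suc n)" and ?c = "\<lambda>p. crossing l (fst p) (snd p)"
  let ?J = "{Suc n + 1..Suc n + ?t}"
  have off: "off_crossings \<alpha> l Y" using assms(1) by (simp add: balanced_def)
  then have finY: "finite Y" by (simp add: off_crossings_def[OF general])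
  obtain A p where A: "A \<subseteq> Y \<inter> l (Suc n)" "card A = 2 * ?t"
    and p: "\<forall>j\<in>?J. p j \<in> Y \<inter> l j"
    and Z': "Z' = scheme l Y (double_pairs n) - mset_set (A \<union> p ` ?J)
      + (\<Sum>j\<in>?J. replicate_mset 2 (crossing l (Suc n) j))"
    and s: "s_par h \<alpha> (Suc n) \<noteq> 0"
    using st unfolding step_def Let_def balanced_reduced[OF assms(1)] by auto
  have n: "Suc n \<in> {1..\<alpha>}" using s s_par_le[of "Suc n"] by auto
  have J: "j \<in> {1..\<alpha>}" if "j \<in> ?J" for j using double_pairs_bound[of "Suc n" j] that by auto
  have line: "P \<in> l k \<longleftrightarrow> k = i" if "P \<in> Y" "P \<in> l i" "i \<in> {1..\<alpha>}" "k \<in> {1..\<alpha>}" for P i k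
    using off_crossings_unique_line[OF general off that(1,3,2,4)] .
  let ?B = "A \<union> p ` ?J"
  have BY: "?B \<subseteq> Y" using A(1) p by blast
  then have finB: "finite ?B" using finY by (rule finite_subset)
  have cardB: "card (?B \<inter> l k) = (if k = Suc n then 2 * ?t else if k \<in> ?J then 1 else 0)"
    if k: "k \<in> {1..\<alpha>}" for k
  proof -
    have "A \<inter> l k = (if k = Suc n then A else {})" using A(1) line[OF _ _ n k] by auto
    moreover have "p ` ?J \<inter> l k = (if k \<in> ?J then {p k} else {})"
      using p line[OF _ _ J k] by auto
    ultimately have "?B \<inter> l k = (if k = Suc n then A else {}) \<union> (if k \<in> ?J then {p k} else {})"
      by (simp only: Int_Un_distrib2)
    then show ?thesis using A(2) by simp
  qed
  have "balanced (Suc n) (Y - ?B)"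
    unfolding balanced_def
  proof (intro conjI ballI)
    show "off_crossings \<alpha> l (Y - ?B)"
      using off unfolding off_crossings_def[OF general] by blast
  next
    fix k assume k: "k \<in> {1..\<alpha>}"
    have Yk: "card ((Y - ?B) \<inter> l k) + card (?B \<inter> l k) = card (Y \<inter> l k)"
      using finY BY by (rule card_Diff_Int)
    have split: "card {q \<in> double_pairs (Suc n). Q q}
        = card {q \<in> double_pairs n. Q q} + card {q \<in> Pair (Suc n) ` ?J. Q q}" for Q
      unfolding double_pairs_Suc using finite_double_pairs double_pairs_Suc_disjoint
      by (intro card_Collect_Un) simp_all
    have "{q \<in> Pair (Suc n) ` ?J. fst q = k} = (if k = Suc n then Pair (Suc n) ` ?J else {})"
      by auto
    then have fst: "card {q \<in> Pair (Suc n) ` ?J. fst q = k} = (if k = Suc n then ?t else 0)"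
      by (simp add: card_image inj_on_def)
    have "{q \<in> Pair (Suc n) ` ?J. snd q = k} = (if k \<in> ?J then {(Suc n, k)} else {})"
      by auto
    then have snd: "card {q \<in> Pair (Suc n) ` ?J. snd q = k} = (if k \<in> ?J then 1 else 0)"
      by simp
    have "card (Y \<inter> l k) + 2 * card {p \<in> double_pairs n. fst p = k}
        + card {p \<in> double_pairs n. snd p = k} = conjugate h k"
      using assms(1) k unfolding balanced_def by blast
    then show "card ((Y - ?B) \<inter> l k) + 2 * card {p \<in> double_pairs (Suc n). fst p = k}
        + card {p \<in> double_pairs (Suc n). snd p = k} = conjugate h k"
      using Yk cardB[OF k] unfolding split fst snd by (auto split: if_splits)
  qed
  moreover have "Z' = scheme l (Y - ?B) (double_pairs (Suc n))"
  proof -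
    have "(\<Sum>q\<in>double_pairs (Suc n). replicate_mset 2 (?c q))
        = (\<Sum>q\<in>double_pairs n. replicate_mset 2 (?c q)) + (\<Sum>j\<in>?J. replicate_mset 2 (crossing l (Suc n) j))"
      unfolding double_pairs_Suc
      by (subst sum.union_disjoint)
        (simp_all add: finite_double_pairs double_pairs_Suc_disjoint[simplified] sum.reindex inj_on_def)
    moreover have "mset_set ?B \<subseteq># mset_set Y"
      using BY finY by (rule subset_imp_msubset_mset_set)
    moreover have "mset_set (Y - ?B) = mset_set Y - mset_set ?B"
      using BY finY by (rule mset_set_Diff[rotated])
    ultimately show ?thesis
      unfolding Z' scheme_def[OF general]
      by (simp only: subset_mset.add_diff_assoc2[symmetric] add.assoc)
  qed
  ultimately show ?thesis by auto
qed

text \<open>After \<open>n\<close> steps line \<open>n + 1\<close> has at least \<open>h\<^bsub>n+1\<^esub>\<^sup>\<star> - n \<ge> 2t\<close> reduced points. The next \<open>t\<close> lines have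
  \<open>h\<^sub>j\<^sup>\<star> \<ge> n + 1\<close>, as \<open>t \<le> s\<close>, so at least one reduced point is left on each of them.\<close>
lemma balanced_step_exists:
  assumes "balanced n Y" and s: "s_par h \<alpha> (n + 1) \<noteq> 0"
  shows "\<exists>Z'. step h \<alpha> l (n + 1) (scheme l Y (double_pairs n)) Z'"
proof -
  let ?t = "t_par h \<alpha> (n + 1)"
  let ?J = "{n + 1 + 1..n + 1 + ?t}"
  have off: "off_crossings \<alpha> l Y" using assms(1) by (simp add: balanced_def)
  then have finY: "finite Y" by (simp add: off_crossings_def[OF general])
  have n: "n + 1 \<in> {1..\<alpha>}" using s s_par_le[of "n + 1"] by auto
  have J: "j \<in> {1..\<alpha>}" if "j \<in> ?J" for j using double_pairs_bound[of "n + 1" j] that by auto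
  have "2 * ?t \<le> conjugate h (n + 1) - n" unfolding t_par_def by simp
  also have "\<dots> \<le> card (Y \<inter> l (n + 1))" using balanced_card_ge[OF assms(1)] n by simp
  finally obtain A where A: "A \<subseteq> Y \<inter> l (n + 1)" "card A = 2 * ?t"
    using obtain_subset_with_card_n by metis
  have "\<forall>j\<in>?J. \<exists>P. P \<in> Y \<inter> l j"
  proof
    fix j assume j: "j \<in> ?J"
    then have "n + 1 \<le> conjugate h j" by (intro s_par_initial) (auto simp: t_par_def)
    then have "0 < card (Y \<inter> l j)" using balanced_card_ge[OF assms(1), of j] j J[OF j] by auto
    then show "\<exists>P. P \<in> Y \<inter> l j" by (auto simp: card_gt_0_iff)
  qed
  then obtain p where p: "\<forall>j\<in>?J. p j \<in> Y \<inter> l j" by (rule bchoice[THEN exE])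
  have line: "k = i" if "P \<in> Y" "P \<in> l i" "P \<in> l k" "i \<in> {1..\<alpha>}" "k \<in> {1..\<alpha>}" for P i k
    using off_crossings_unique_line[OF general off that(1,4,2,5)] that(3) by blast
  have "inj_on p ?J"
  proof (rule inj_onI)
    fix i j assume ij: "i \<in> ?J" "j \<in> ?J" "p i = p j"
    have "p i \<in> Y" "p i \<in> l i" "p j \<in> l j" using ij(1,2) p by blast+
    then show "i = j" using line[of "p i" j i] J ij by simp
  qed
  moreover have "A \<inter> p ` ?J = {}"
  proof (rule ccontr)
    assume "A \<inter> p ` ?J \<noteq> {}"
    then obtain j where j: "j \<in> ?J" "p j \<in> A" by blast
    have "p j \<in> Y" "p j \<in> l j" "p j \<in> l (n + 1)" using j p A(1) by blast+
    then have "j = n + 1" using line[of "p j" "n + 1" j] J[OF j(1)] n by blast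
    then show False using j(1) by simp
  qed
  ultimately show ?thesis
    unfolding step_def Let_def balanced_reduced[OF assms(1)] using s A p by blast
qed

lemma balanced_reachable:
  assumes "reachable h \<alpha> l Z\<^sub>0 n Z" "initial h \<alpha> l Z\<^sub>0"
  shows "\<exists>Y. balanced n Y \<and> Z = scheme l Y (double_pairs n)"
  using assms
proof (induction rule: reachable.induct)
  case 1
  then show ?case by (rule balanced_initial)
next
  case (2 n Z Z')
  then show ?case using balanced_step by blast
qed

end
end

theorem mainTheorem2:
  fixes h :: "nat list" and \<alpha> :: nat
  assumes "valid_hilbert h \<alpha>"
  shows "(\<exists>l :: nat \<Rightarrow> ('k::{alg_closed_field, field_char_0}) proj_plane set. general_lines \<alpha> l) \<and>
    (\<forall>l :: nat \<Rightarrow> 'k proj_plane set. general_lines \<alpha> l \<longrightarrow>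
      (\<exists>Z\<^sub>0. initial h \<alpha> l Z\<^sub>0) \<and>
      (\<forall>Z\<^sub>0. initial h \<alpha> l Z\<^sub>0 \<longrightarrow>
        hilbert_fun (fat_ideal Z\<^sub>0) = sum_hilbert h \<and>
        (\<forall>n Z. reachable h \<alpha> l Z\<^sub>0 n Z \<and> s_par h \<alpha> (n + 1) \<noteq> 0 \<longrightarrow>
          (\<exists>Z'. step h \<alpha> l (n + 1) Z Z')) \<and>
        \<not> (\<exists>Y. Y 0 = Z\<^sub>0 \<and> (\<forall>n. step h \<alpha> l (n + 1) (Y n) (Y (n + 1)))) \<and>
        (\<forall>Z. outputs h \<alpha> l Z\<^sub>0 Z \<longrightarrow>
          set_mset Z = reduced_points Z \<union> double_points Z \<and>
          hilbert_fun (fat_ideal Z) = sum_hilbert h)))"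
proof (rule conjI[OF general_lines_exist], intro allI impI conjI)
  fix l :: "nat \<Rightarrow> 'k proj_plane set"
  assume general: "general_lines \<alpha> l"
  obtain X where X: "off_crossings \<alpha> l X \<and> (\<forall>i\<in>{1..\<alpha>}. card (X \<inter> l i) = conjugate h i)"
    using off_crossings_exists[OF general, of "conjugate h"] ..
  have "initial h \<alpha> l (mset_set X)"
    unfolding initial_def
    using X[unfolded off_crossings_def[OF general]] by (intro exI[of _ X] conjI refl) simp_all
  then show "\<exists>Z\<^sub>0. initial h \<alpha> l Z\<^sub>0" by (rule exI)
next
  fix l :: "nat \<Rightarrow> 'k proj_plane set" and Z\<^sub>0
  assume general: "general_lines \<alpha> l" and init: "initial h \<alpha> l Z\<^sub>0"
  note facts = assms general
  show "hilbert_fun (fat_ideal Z\<^sub>0) = sum_hilbert h"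
    using balanced_initial[OF facts init] balanced_hilbert_fun[OF facts] by auto
  show "\<not> (\<exists>Y. Y 0 = Z\<^sub>0 \<and> (\<forall>n. step h \<alpha> l (n + 1) (Y n) (Y (n + 1))))"
  proof
    assume "\<exists>Y. Y 0 = Z\<^sub>0 \<and> (\<forall>n. step h \<alpha> l (n + 1) (Y n) (Y (n + 1)))"
    then obtain Y where "\<forall>n. step h \<alpha> l (n + 1) (Y n) (Y (n + 1))" by blast
    \<comment> \<open>No line is left after step \<open>\<alpha>\<close>.\<close>
    then have "s_par h \<alpha> (\<alpha> + 1) \<noteq> 0" unfolding step_def by blast
    then show False using s_par_le[OF assms, of "\<alpha> + 1"] by simp
  qed
  show "\<exists>Z'. step h \<alpha> l (n + 1) Z Z'" if "reachable h \<alpha> l Z\<^sub>0 n Z \<and> s_par h \<alpha> (n + 1) \<noteq> 0" for n Z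
    using balanced_reachable[OF facts _ init] balanced_step_exists[OF facts] that by blast
  show "set_mset Z = reduced_points Z \<union> double_points Z"
    and "hilbert_fun (fat_ideal Z) = sum_hilbert h" if out: "outputs h \<alpha> l Z\<^sub>0 Z" for Z
  proof -
    obtain n Y where "balanced h \<alpha> l n Y" "Z = scheme l Y (double_pairs h \<alpha> n)"
      using out balanced_reachable[OF facts _ init] unfolding outputs_def by blast
    then show "set_mset Z = reduced_points Z \<union> double_points Z"
      and "hilbert_fun (fat_ideal Z) = sum_hilbert h"
      using balanced_support[OF facts] balanced_hilbert_fun[OF facts] by auto
  qed
qed

end
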